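(* Let $\mathscr{C}$ be a category and $\mathbf{W}$ a class of morphisms of $\mathscr{C}$ such that $(\mathscr{C},\mathbf{W})$ satisfies axioms (CF1)--(CF4) for a right calculus of fractions. Given any pair of morphisms $f^1:B^1\rightarrow A$ and $f^2:B^2\rightarrow A$ in $\mathscr{C}$, the following facts are equivalent: (iii) for any pair of morphisms $\mathrm{w}^1:B^1\rightarrow\overline{B}^1$ and $\mathrm{w}^2:B^2\rightarrow\overline{B}^2$ in $\mathbf{W}$, the pair of morphisms $[B^1,\mathrm{w}^1,f^1]:\overline{B}^1\rightarrow A$ and $[B^2,\mathrm{w}^2,f^2]:\overline{B}^2\rightarrow A$ admits a (strong) fiber product in the right category of fractions $\mathscr{C}[\mathbf{W}^{-1}]$; (iv) there are an object $C$ in $\mathscr{C}$ and a pair of morphisms $p^1:C\rightarrow B^1$, $p^2:C\rightarrow B^2$, such that $f^1\circ p^1=f^2\circ p^2$ and such that the commutative square formed by $[C,\mathrm{id}_C,p^1]:C\to B^1$, $[C,\mathrm{id}_C,p^2]:C\to B^2$, $[B^1,\mathrm{id}_{B^1},f^1]:B^1\to A$ and $[B^2,\mathrm{id}_{B^2},f^2]:B^2\to A$ is a (strong) fiber product in $\mathscr{C}[\mathbf{W}^{-1}]$. Moreover, given any set of data $(C,p^1:C\rightarrow B^1,p^2:C\rightarrow B^2)$ such that $f^1\circ p^1=f^2\circ p^2$, the square in (iv) is a (strong) fiber product in $\mathscr{C}[\mathbf{W}^{-1}]$ if and only if the following 2 conditions hold: (d) given any object $D$ and any pair of morphisms $q^m:D\rightarrow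 B^m$ for $m=1,2$, such that $f^1\circ q^1=f^2\circ q^2$ in $\mathscr{C}$, there are an object $E$, a morphism $\mathrm{v}:E\rightarrow D$ in $\mathbf{W}$ and a morphism $q:E\rightarrow C$, such that $q^m\circ\mathrm{v}=p^m\circ q$ for each $m=1,2$; (e) given any set of data $(D,q^1,q^2,E,\mathrm{v},q)$ as in (d), if there is another choice of data $\widetilde{E}$, $\widetilde{\mathrm{v}}:\widetilde{E}\rightarrow D$ in $\mathbf{W}$ and $\widetilde{q}:\widetilde{E}\rightarrow C$, such that $q^m\circ\widetilde{\mathrm{v}}=p^m\circ\widetilde{q}$ for each $m=1,2$, then there are an object $F$, a morphism $\mathrm{u}:F\rightarrow E$ in $\mathbf{W}$ and a morphism $\widetilde{\mathrm{u}}:F\rightarrow\widetilde{E}$, such that $\mathrm{v}\circ\mathrm{u}=\widetilde{\mathrm{v}}\circ\widetilde{\mathrm{u}}$ and $q\circ\mathrm{u}=\widetilde{q}\circ\widetilde{\mathrm{u}}$.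
   Context: The axiom of choice is assumed. "Strong fiber product" means the usual pullback in a category. Axioms (CF) for a right calculus of fractions: (CF1) $\mathbf{W}$ contains all identities of $\mathscr{C}$; (CF2) $\mathbf{W}$ is closed under compositions; (CF3) for every $\mathrm{w}:A\to B$ in $\mathbf{W}$ and every $f:C\to B$ there are an object $D$, $\mathrm{w}':D\to C$ in $\mathbf{W}$ and $f':D\to A$ with $f\circ\mathrm{w}'=\mathrm{w}\circ f'$; (CF4) for every $\mathrm{w}:B\to A$ in $\mathbf{W}$ and all $f^1,f^2:C\to B$ with $\mathrm{w}\circ f^1=\mathrm{w}\circ f^2$ there are an object $D$ and $\mathrm{v}:D\to C$ in $\mathbf{W}$ with $f^1\circ\mathrm{v}=f^2\circ\mathrm{v}$. The right category of fractions $\mathscr{C}[\mathbf{W}^{-1}]$ has the same objects as $\mathscr{C}$; a morphism $A\to B$ is an equivalence class $[A',\mathrm{w},f]$ of triples with $\mathrm{w}:A'\to A$ in $\mathbf{W}$ and $f:A'\to B$ in $\mathscr{C}$, where $(A^1,\mathrm{w}^1,f^1)$ and $(A^2,\mathrm{w}^2,f^2)$ are equivalent iff there are an object $A^3$ and morphisms $\mathrm{v}^m:A^3\to A^m$ ($m=1,2$) with $\mathrm{w}^1\circ\mathrm{v}^1\in\mathbf{W}$, $\mathrm{w}^1\circ\mathrm{v}^1=\mathrm{w}^2\circ\mathrm{v}^2$ and $f^1\circ\mathrm{v}^1=f^2\circ\mathrm{v}^2$. The composition $[B',\mathrm{v},g]\circ[A',\mathrm{w},f]$ is $[A'',\mathrm{w}\circ\mathrm{v}',g\circ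 f']$, where $\mathrm{v}':A''\to A'$ in $\mathbf{W}$ and $f':A''\to B'$ are any morphisms with $f\circ\mathrm{v}'=\mathrm{v}\circ f'$ (this is well defined). *)

theory Defs
  imports Main
begin

record ('o, 'm) category =
  Obj :: "'o set"
  Mor :: "'m set"
  Dom :: "'m \<Rightarrow> 'o"
  Cod :: "'m \<Rightarrow> 'o"
  Id :: "'o \<Rightarrow> 'm" ("\<i>\<d>\<index>")
  Comp :: "'m \<Rightarrow> 'm \<Rightarrow> 'm" (infixr "\<cdot>\<index>" 70)  \<comment> \<open>\<open>g \<cdot> f\<close> is ``first \<open>f\<close>, then \<open>g\<close>''\<close>

definition hom :: "('o, 'm) category \<Rightarrow> 'o \<Rightarrow> 'o \<Rightarrow> 'm set" where
  "hom C A B = {f \<in> Mor C. Dom C f = A \<and> Cod C f = B}"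

locale category =
  fixes C :: "('o, 'm) category" (structure)
  assumes Dom_in_Obj: "f \<in> Mor C \<Longrightarrow> Dom C f \<in> Obj C"
    and Cod_in_Obj: "f \<in> Mor C \<Longrightarrow> Cod C f \<in> Obj C"
    and Id_in_hom: "A \<in> Obj C \<Longrightarrow> \<i>\<d> A \<in> hom C A A"
    and Comp_in_hom: "\<lbrakk>f \<in> hom C A B; g \<in> hom C B D\<rbrakk> \<Longrightarrow> g \<cdot> f \<in> hom C A D"
    and Comp_Id: "f \<in> hom C A B \<Longrightarrow> f \<cdot> \<i>\<d> A = f"
    and Id_Comp: "f \<in> hom C A B \<Longrightarrow> \<i>\<d> B \<cdot> f = f"
    and Comp_assoc: "\<lbrakk>f \<in> hom C A B; g \<in> hom C B D; h \<in> hom C D E\<rbrakk>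
      \<Longrightarrow> (h \<cdot> g) \<cdot> f = h \<cdot> (g \<cdot> f)"

definition is_fiber_product ::
    "('o, 'm) category \<Rightarrow> 'o \<Rightarrow> 'm \<Rightarrow> 'm \<Rightarrow> 'm \<Rightarrow> 'm \<Rightarrow> bool" where
  "is_fiber_product C P p1 p2 f1 f2 \<longleftrightarrow>
     P \<in> Obj C \<and> f1 \<in> Mor C \<and> f2 \<in> Mor C \<and> Cod C f1 = Cod C f2 \<and>
     p1 \<in> hom C P (Dom C f1) \<and> p2 \<in> hom C P (Dom C f2) \<and>
     f1 \<cdot>\<^bsub>C\<^esub> p1 = f2 \<cdot>\<^bsub>C\<^esub> p2 \<and>
     (\<forall>X q1 q2. X \<in> Obj C \<and> q1 \<in> hom C X (Dom C f1) \<and> q2 \<in> hom C X (Dom C f2) \<and>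
        f1 \<cdot>\<^bsub>C\<^esub> q1 = f2 \<cdot>\<^bsub>C\<^esub> q2 \<longrightarrow>
        (\<exists>!h. h \<in> hom C X P \<and> p1 \<cdot>\<^bsub>C\<^esub> h = q1 \<and> p2 \<cdot>\<^bsub>C\<^esub> h = q2))"

locale right_calculus_of_fractions = category C for C :: "('o, 'm) category" (structure) +
  fixes W :: "'m set"
  assumes W_subset: "W \<subseteq> Mor C"
    and CF1: "A \<in> Obj C \<Longrightarrow> \<i>\<d> A \<in> W"
    and CF2: "\<lbrakk>w \<in> W; v \<in> W; Cod C w = Dom C v\<rbrakk> \<Longrightarrow> v \<cdot> w \<in> W"
    and CF3: "\<lbrakk>w \<in> W; w \<in> hom C A B; f \<in> hom C D B\<rbrakk>
      \<Longrightarrow> \<exists>E w' f'. w' \<in> W \<and> w' \<in> hom C E D \<and> f' \<in> hom C E A \<and> f \<cdot> w' = w \<cdot> f'"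
    and CF4: "\<lbrakk>w \<in> W; w \<in> hom C B A; f1 \<in> hom C D B; f2 \<in> hom C D B; w \<cdot> f1 = w \<cdot> f2\<rbrakk>
      \<Longrightarrow> \<exists>E v. v \<in> W \<and> v \<in> hom C E D \<and> f1 \<cdot> v = f2 \<cdot> v"

definition spans :: "('o, 'm) category \<Rightarrow> 'm set \<Rightarrow> 'o \<Rightarrow> 'o \<Rightarrow> ('o \<times> 'm \<times> 'm) set" where
  "spans C W A B = {(A', w, f). w \<in> W \<and> w \<in> hom C A' A \<and> f \<in> hom C A' B}"

definition span_rel ::
    "('o, 'm) category \<Rightarrow> 'm set \<Rightarrow> 'o \<Rightarrow> 'o \<Rightarrow> (('o \<times> 'm \<times> 'm) \<times> ('o \<times> 'm \<times> 'm)) set" where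
  "span_rel C W A B =
     {((A1, w1, f1), (A2, w2, f2)).
        (A1, w1, f1) \<in> spans C W A B \<and> (A2, w2, f2) \<in> spans C W A B \<and>
        (\<exists>A3 v1 v2. v1 \<in> hom C A3 A1 \<and> v2 \<in> hom C A3 A2 \<and>
           w1 \<cdot>\<^bsub>C\<^esub> v1 \<in> W \<and> w1 \<cdot>\<^bsub>C\<^esub> v1 = w2 \<cdot>\<^bsub>C\<^esub> v2 \<and> f1 \<cdot>\<^bsub>C\<^esub> v1 = f2 \<cdot>\<^bsub>C\<^esub> v2)}"

text \<open>The class \<open>[A', w, f]\<close>; its source and target are determined by the codomains of \<open>w\<close> and \<open>f\<close>.\<close>

definition frac :: "('o, 'm) category \<Rightarrow> 'm set \<Rightarrow> 'o \<Rightarrow> 'm \<Rightarrow> 'm \<Rightarrow> ('o \<times> 'm \<times> 'm) set" where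
  "frac C W A' w f = span_rel C W (Cod C w) (Cod C f) `` {(A', w, f)}"

definition frac_hom ::
    "('o, 'm) category \<Rightarrow> 'm set \<Rightarrow> 'o \<Rightarrow> 'o \<Rightarrow> ('o \<times> 'm \<times> 'm) set set" where
  "frac_hom C W A B = spans C W A B // span_rel C W A B"

text \<open>The composite does not depend on the representatives nor on the completion \<open>(v', f')\<close> of the
  square, so the description operator below picks out a uniquely determined class.\<close>

definition frac_comp ::
    "('o, 'm) category \<Rightarrow> 'm set \<Rightarrow> ('o \<times> 'm \<times> 'm) set \<Rightarrow> ('o \<times> 'm \<times> 'm) set
      \<Rightarrow> ('o \<times> 'm \<times> 'm) set" where
  "frac_comp C W Y X =
     (THE Z. \<exists>A B D A' w f B' v g A'' v' f'.
        (A', w, f) \<in> spans C W A B \<and> X = frac C W A' w f \<and>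
        (B', v, g) \<in> spans C W B D \<and> Y = frac C W B' v g \<and>
        v' \<in> W \<and> v' \<in> hom C A'' A' \<and> f' \<in> hom C A'' B' \<and> f \<cdot>\<^bsub>C\<^esub> v' = v \<cdot>\<^bsub>C\<^esub> f' \<and>
        Z = frac C W A'' (w \<cdot>\<^bsub>C\<^esub> v') (g \<cdot>\<^bsub>C\<^esub> f'))"

definition fractions :: "('o, 'm) category \<Rightarrow> 'm set \<Rightarrow> ('o, ('o \<times> 'm \<times> 'm) set) category" where
  "fractions C W =
     \<lparr>Obj = Obj C,
      Mor = (\<Union>A \<in> Obj C. \<Union>B \<in> Obj C. frac_hom C W A B),
      Dom = (\<lambda>X. THE A. \<exists>B. X \<in> frac_hom C W A B),
      Cod = (\<lambda>X. THE B. \<exists>A. X \<in> frac_hom C W A B),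
      Id = (\<lambda>A. frac C W A (\<i>\<d>\<^bsub>C\<^esub> A) (\<i>\<d>\<^bsub>C\<^esub> A)),
      Comp = frac_comp C W\<rparr>"

end

theory Submission
  imports Defs
begin

text \<open>Two fractions with the same source have a common denominator, and an equality of fractions
  becomes an equality in \<open>C\<close> after precomposition with some element of \<open>W\<close>. Hence every cone over
  \<open>(f1, f2)\<close> in \<open>C[W\<^sup>-\<^sup>1]\<close> has the form \<open>([D, u, g1], [D, u, g2])\<close> with \<open>f1 \<cdot> g1 = f2 \<cdot> g2\<close> in \<open>C\<close>.
  Up to the isomorphism \<open>u\<close>, the universal property is therefore about cones of \<open>C\<close>, for which
  existence and uniqueness of the factorization are (d) and (e). A fiber product cone in \<open>C[W\<^sup>-\<^sup>1]\<close>
  can likewise be replaced by \<open>(D, g1, g2)\<close>, which gives (iii) \<open>\<Rightarrow>\<close> (iv); conversely, \<open>[B, w, f]\<close> is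
  \<open>[B, id, f]\<close> precomposed with the inverse of the isomorphism \<open>[B, id, w]\<close>.\<close>

section \<open>Fiber products and isomorphisms\<close>

context category
begin

section \<open>Typing rules and transport of fiber products along isomorphisms\<close>

lemma homI: "f \<in> Mor C \<Longrightarrow> Dom C f = A \<Longrightarrow> Cod C f = B \<Longrightarrow> f \<in> hom C A B"
  by (simp add: hom_def)

lemma homD:
  assumes "f \<in> hom C A B"
  shows "f \<in> Mor C" "Dom C f = A" "Cod C f = B" "A \<in> Obj C" "B \<in> Obj C"
  using assms Dom_in_Obj Cod_in_Obj by (auto simp: hom_def)

text \<open>Stated with \<open>Mor\<close>, \<open>Dom\<close> and \<open>Cod\<close> instead of
  \<open>hom\<close>, so that the simplifier has no intermediate object to guess.\<close>

lemma Comp_Mor [simp]: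
  assumes "f \<in> Mor C" "g \<in> Mor C" "Cod C f = Dom C g"
  shows "g \<cdot> f \<in> Mor C" "Dom C (g \<cdot> f) = Dom C f" "Cod C (g \<cdot> f) = Cod C g"
  using Comp_in_hom[of f "Dom C f" "Dom C g" g "Cod C g"] assms by (auto simp: hom_def)

lemma Id_Mor [simp]:
  assumes "A \<in> Obj C"
  shows "\<i>\<d> A \<in> Mor C" "Dom C (\<i>\<d> A) = A" "Cod C (\<i>\<d> A) = A"
  using Id_in_hom[OF assms] by (auto simp: hom_def)

lemma Comp_Id' [simp]: "f \<in> Mor C \<Longrightarrow> Dom C f = A \<Longrightarrow> f \<cdot> \<i>\<d> A = f"
  and Id_Comp' [simp]: "f \<in> Mor C \<Longrightarrow> Cod C f = A \<Longrightarrow> \<i>\<d> A \<cdot> f = f"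
  using Comp_Id Id_Comp by (auto simp: hom_def)

lemma Comp_assoc' [simp]:
  assumes "f \<in> Mor C" "g \<in> Mor C" "h \<in> Mor C" "Cod C f = Dom C g" "Cod C g = Dom C h"
  shows "(h \<cdot> g) \<cdot> f = h \<cdot> (g \<cdot> f)"
  using Comp_assoc[of f "Dom C f" "Dom C g" g "Dom C h" h "Cod C h"] assms by (auto simp: hom_def)

text \<open>Composites are kept nested to the right, where a commutative square is no longer a
  subterm of a longer composite. This form restores rewriting along the square.\<close>

lemma Comp_eq_extend:
  assumes "g \<cdot> f = g' \<cdot> f'" "f \<in> hom C B D" "g \<in> hom C D E" "f' \<in> hom C B D'" "g' \<in> hom C D' E"
    and "x \<in> hom C A B"
  shows "g \<cdot> (f \<cdot> x) = g' \<cdot> (f' \<cdot> x)"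
proof -
  have "g \<cdot> (f \<cdot> x) = (g \<cdot> f) \<cdot> x" using assms(2-6) by (simp add: homD)
  also have "\<dots> = (g' \<cdot> f') \<cdot> x" using assms(1) by simp
  also have "\<dots> = g' \<cdot> (f' \<cdot> x)" using assms(2-6) by (simp add: homD)
  finally show ?thesis .
qed

text \<open>Composition with \<open>i\<close> and with \<open>j\<close> gives inverse bijections
  between maps into \<open>Q\<close> and maps into \<open>P\<close>, compatible with the cone
  equations.\<close>

lemma is_fiber_product_iso_apex:
  assumes P: "is_fiber_product C P p1 p2 f1 f2"
    and i: "i \<in> hom C Q P" and j: "j \<in> hom C P Q" and ij: "i \<cdot> j = \<i>\<d> P" and ji: "j \<cdot> i = \<i>\<d> Q"
  shows "is_fiber_product C Q (p1 \<cdot> i) (p2 \<cdot> i) f1 f2"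
proof -
  note [simp] = homD[OF i] homD[OF j]
  have P': "P \<in> Obj C" "f1 \<in> Mor C" "f2 \<in> Mor C" "Cod C f1 = Cod C f2"
     "p1 \<in> hom C P (Dom C f1)" "p2 \<in> hom C P (Dom C f2)" "f1 \<cdot> p1 = f2 \<cdot> p2"
    and U: "\<And>X q1 q2. \<lbrakk>X \<in> Obj C; q1 \<in> hom C X (Dom C f1); q2 \<in> hom C X (Dom C f2);
        f1 \<cdot> q1 = f2 \<cdot> q2\<rbrakk> \<Longrightarrow> \<exists>!h. h \<in> hom C X P \<and> p1 \<cdot> h = q1 \<and> p2 \<cdot> h = q2"
    using P unfolding is_fiber_product_def by blast+
  note [simp] = P'(1-4) homD[OF P'(5)] homD[OF P'(6)]
  show ?thesis unfolding is_fiber_product_def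
  proof (intro conjI allI impI)
    show "f1 \<cdot> p1 \<cdot> i = f2 \<cdot> p2 \<cdot> i"
      by (rule Comp_eq_extend[OF P'(7), where B = P and D = "Dom C f1" and E = "Cod C f2"
            and D' = "Dom C f2" and A = Q]) (auto intro!: homI)
    fix X q1 q2
    assume "X \<in> Obj C \<and> q1 \<in> hom C X (Dom C f1) \<and> q2 \<in> hom C X (Dom C f2) \<and> f1 \<cdot> q1 = f2 \<cdot> q2"
    then obtain h where h: "h \<in> hom C X P" "p1 \<cdot> h = q1" "p2 \<cdot> h = q2"
      and uniq: "\<And>h'. h' \<in> hom C X P \<Longrightarrow> p1 \<cdot> h' = q1 \<Longrightarrow> p2 \<cdot> h' = q2 \<Longrightarrow> h' = h"
      using U[of X q1 q2] by blast
    note [simp] = homD[OF h(1)]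
    have ijh: "i \<cdot> j \<cdot> h = h"
      using arg_cong[OF ij, of "\<lambda>x. x \<cdot> h"] by simp
    show "\<exists>!k. k \<in> hom C X Q \<and> (p1 \<cdot> i) \<cdot> k = q1 \<and> (p2 \<cdot> i) \<cdot> k = q2"
    proof (rule ex1I[of _ "j \<cdot> h"])
      show "j \<cdot> h \<in> hom C X Q \<and> (p1 \<cdot> i) \<cdot> j \<cdot> h = q1 \<and> (p2 \<cdot> i) \<cdot> j \<cdot> h = q2"
        using h ijh by (auto intro!: homI)
      fix k assume k: "k \<in> hom C X Q \<and> (p1 \<cdot> i) \<cdot> k = q1 \<and> (p2 \<cdot> i) \<cdot> k = q2"
      then have kh: "k \<in> hom C X Q" by blast
      note [simp] = homD[OF kh]
      \<comment> \<open>\<open>i \<cdot> k\<close> mediates into \<open>P\<close>, so uniqueness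
        there determines it, and \<open>j\<close> recovers \<open>k\<close>.\<close>
      have "i \<cdot> k = h" using k by (intro uniq) (auto intro!: homI)
      then have "j \<cdot> h = (j \<cdot> i) \<cdot> k" by simp
      then show "k = j \<cdot> h" unfolding ji by simp
    qed
  qed (auto intro!: homI)
qed

text \<open>A cone \<open>(q1, q2)\<close> over the new pair is the same as the cone
  \<open>(j1 \<cdot> q1, j2 \<cdot> q2)\<close> over the old one.\<close>

lemma is_fiber_product_iso_feet:
  assumes P: "is_fiber_product C P p1 p2 f1 f2"
    and f: "f1 \<in> hom C B1 A" "f2 \<in> hom C B2 A"
    and i: "i1 \<in> hom C B1 D1" "i2 \<in> hom C B2 D2"
    and j: "j1 \<in> hom C D1 B1" "j2 \<in> hom C D2 B2"
    and ij: "i1 \<cdot> j1 = \<i>\<d> D1" "i2 \<cdot> j2 = \<i>\<d> D2"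
    and ji: "j1 \<cdot> i1 = \<i>\<d> B1" "j2 \<cdot> i2 = \<i>\<d> B2"
  shows "is_fiber_product C P (i1 \<cdot> p1) (i2 \<cdot> p2) (f1 \<cdot> j1) (f2 \<cdot> j2)"
proof -
  note [simp] = homD[OF f(1)] homD[OF f(2)] homD[OF i(1)] homD[OF i(2)] homD[OF j(1)] homD[OF j(2)]
  have P': "P \<in> Obj C" "p1 \<in> hom C P B1" "p2 \<in> hom C P B2" "f1 \<cdot> p1 = f2 \<cdot> p2"
    and U: "\<And>X q1 q2. \<lbrakk>X \<in> Obj C; q1 \<in> hom C X B1; q2 \<in> hom C X B2;
        f1 \<cdot> q1 = f2 \<cdot> q2\<rbrakk> \<Longrightarrow> \<exists>!h. h \<in> hom C X P \<and> p1 \<cdot> h = q1 \<and> p2 \<cdot> h = q2"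
    using P unfolding is_fiber_product_def by auto
  note [simp] = P'(1) homD[OF P'(2)] homD[OF P'(3)]
  \<comment> \<open>The inverse laws with a factor appended: the shape in which they occur in
    composites nested to the right.\<close>
  have ji': "j1 \<cdot> i1 \<cdot> x = x" if "x \<in> Mor C" "Cod C x = B1" for x
    using arg_cong[OF ji(1), of "\<lambda>y. y \<cdot> x"] that by simp
  have ji'': "j2 \<cdot> i2 \<cdot> x = x" if "x \<in> Mor C" "Cod C x = B2" for x
    using arg_cong[OF ji(2), of "\<lambda>y. y \<cdot> x"] that by simp
  have ij': "i1 \<cdot> j1 \<cdot> x = x" if "x \<in> Mor C" "Cod C x = D1" for x
    using arg_cong[OF ij(1), of "\<lambda>y. y \<cdot> x"] that by simp
  have ij'': "i2 \<cdot> j2 \<cdot> x = x" if "x \<in> Mor C" "Cod C x = D2" for x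
    using arg_cong[OF ij(2), of "\<lambda>y. y \<cdot> x"] that by simp
  show ?thesis unfolding is_fiber_product_def
  proof (intro conjI allI impI)
    fix X q1 q2
    assume q: "X \<in> Obj C \<and> q1 \<in> hom C X (Dom C (f1 \<cdot> j1)) \<and> q2 \<in> hom C X (Dom C (f2 \<cdot> j2)) \<and>
      (f1 \<cdot> j1) \<cdot> q1 = (f2 \<cdot> j2) \<cdot> q2"
    then have q12: "q1 \<in> hom C X D1" "q2 \<in> hom C X D2" by auto
    note [simp] = homD[OF q12(1)] homD[OF q12(2)]
    have "\<exists>!h. h \<in> hom C X P \<and> p1 \<cdot> h = j1 \<cdot> q1 \<and> p2 \<cdot> h = j2 \<cdot> q2"
      using q by (intro U) (auto intro!: homI)
    \<comment> \<open>Both lifting problems have the same solutions \<open>h\<close>, so unique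
      existence carries over.\<close>
    moreover have "h \<in> hom C X P \<and> p1 \<cdot> h = j1 \<cdot> q1 \<and> p2 \<cdot> h = j2 \<cdot> q2 \<longleftrightarrow>
      h \<in> hom C X P \<and> (i1 \<cdot> p1) \<cdot> h = q1 \<and> (i2 \<cdot> p2) \<cdot> h = q2" (is "?L h \<longleftrightarrow> ?R h") for h
    proof
      assume L: "?L h"
      then have h: "h \<in> hom C X P" by blast
      note [simp] = homD[OF h]
      show "?R h" using L by (simp add: ij' ij'')
    next
      assume R: "?R h"
      then have h: "h \<in> hom C X P" by blast
      note [simp] = homD[OF h]
      have "j1 \<cdot> q1 = j1 \<cdot> ((i1 \<cdot> p1) \<cdot> h)" "j2 \<cdot> q2 = j2 \<cdot> ((i2 \<cdot> p2) \<cdot> h)" using R by simp_all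
      then show "?L h" using h by (simp add: ji' ji'')
    qed
    ultimately show "\<exists>!h. h \<in> hom C X P \<and> (i1 \<cdot> p1) \<cdot> h = q1 \<and> (i2 \<cdot> p2) \<cdot> h = q2" by simp
  qed (use P'(4) in \<open>auto intro!: homI simp: ji' ji''\<close>)
qed

end

section \<open>Equality of fractions\<close>

context right_calculus_of_fractions
begin

section \<open>Lifting through denominators\<close>

lemma W_Mor [simp]: "w \<in> W \<Longrightarrow> w \<in> Mor C"
  using W_subset by blast

lemma W_Comp:
  "w \<in> W \<Longrightarrow> v \<in> W \<Longrightarrow> w \<in> hom C A B \<Longrightarrow> v \<in> hom C B D \<Longrightarrow> v \<cdot> w \<in> W"
  using CF2 by (simp add: hom_def)

lemma W_Comp3:
  assumes "w \<cdot> a \<in> W" "s \<in> W" "s \<in> hom C E B" "a \<in> hom C B D" "w \<in> hom C D A"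
  shows "w \<cdot> (a \<cdot> s) \<in> W"
proof -
  have "(w \<cdot> a) \<cdot> s \<in> W"
    using W_Comp[OF assms(2,1,3) Comp_in_hom[OF assms(4,5)]] .
  then show ?thesis using Comp_assoc[OF assms(3,4,5)] by simp
qed

text \<open>A morphism \<open>a\<close> with \<open>w \<cdot> a\<close> in \<open>W\<close> behaves
  in (CF3) like an element of \<open>W\<close>: the square is first completed after composition with
  \<open>w\<close>, then (CF4) cancels \<open>w\<close> at the price of a refinement
  \<open>r\<close>. The legs of equivalent spans are of this kind.\<close>

lemma common_lift:
  assumes w: "w \<in> W" "w \<in> hom C B A" and a: "a \<in> hom C D B" and wa: "w \<cdot> a \<in> W"
    and b: "b \<in> hom C D' B"
  obtains E s t where "s \<in> W" "s \<in> hom C E D'" "t \<in> hom C E D" "b \<cdot> s = a \<cdot> t"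
proof -
  obtain E s t where st: "s \<in> W" "s \<in> hom C E D'" "t \<in> hom C E D" "(w \<cdot> b) \<cdot> s = (w \<cdot> a) \<cdot> t"
    using CF3[OF wa Comp_in_hom[OF a w(2)] Comp_in_hom[OF b w(2)]] by blast
  note [simp] = homD[OF w(2)] homD[OF a] homD[OF b] homD[OF st(2)] homD[OF st(3)]
  have "w \<cdot> (b \<cdot> s) = w \<cdot> (a \<cdot> t)" using st(4) by simp
  then obtain F r where r: "r \<in> W" "r \<in> hom C F E" "(b \<cdot> s) \<cdot> r = (a \<cdot> t) \<cdot> r"
    using CF4[OF w Comp_in_hom[OF st(2) b] Comp_in_hom[OF st(3) a]] by blast
  note [simp] = homD[OF r(2)]
  show thesis
  proof (rule that[of "s \<cdot> r" F "t \<cdot> r"])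
    show "s \<cdot> r \<in> W" using W_Comp[OF r(1) st(1) r(2) st(2)] .
    show "b \<cdot> s \<cdot> r = a \<cdot> t \<cdot> r" using r(3) by simp
  qed (auto intro!: homI)
qed

section \<open>The equivalence relation on spans\<close>

lemma span_relI:
  assumes "(A1, w1, f1) \<in> spans C W A B" "(A2, w2, f2) \<in> spans C W A B"
    and "v1 \<in> hom C A3 A1" "v2 \<in> hom C A3 A2" "w1 \<cdot> v1 \<in> W" "w1 \<cdot> v1 = w2 \<cdot> v2" "f1 \<cdot> v1 = f2 \<cdot> v2"
  shows "((A1, w1, f1), (A2, w2, f2)) \<in> span_rel C W A B"
  using assms unfolding span_rel_def by blast

lemma span_relE:
  assumes "((A1, w1, f1), (A2, w2, f2)) \<in> span_rel C W A B"
  obtains A3 v1 v2 where "(A1, w1, f1) \<in> spans C W A B" "(A2, w2, f2) \<in> spans C W A B"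
    "v1 \<in> hom C A3 A1" "v2 \<in> hom C A3 A2" "w1 \<cdot> v1 \<in> W" "w1 \<cdot> v1 = w2 \<cdot> v2" "f1 \<cdot> v1 = f2 \<cdot> v2"
  using assms unfolding span_rel_def by blast

lemma spansI: "w \<in> W \<Longrightarrow> w \<in> hom C A' A \<Longrightarrow> f \<in> hom C A' B \<Longrightarrow> (A', w, f) \<in> spans C W A B"
  by (simp add: spans_def)

lemma spansD:
  assumes "(A', w, f) \<in> spans C W A B"
  shows "w \<in> W" "w \<in> hom C A' A" "f \<in> hom C A' B"
  using assms by (auto simp: spans_def)

lemma span_rel_refl:
  assumes "(A', w, f) \<in> spans C W A B"
  shows "((A', w, f), (A', w, f)) \<in> span_rel C W A B"
proof -
  note s = spansD[OF assms]
  note [simp] = s(1) homD[OF s(2)] homD[OF s(3)]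
  show ?thesis
    by (rule span_relI[OF assms assms, of "\<i>\<d> A'" A' "\<i>\<d> A'"]) (auto intro!: homI)
qed

lemma span_rel_sym:
  assumes "((A1, w1, f1), (A2, w2, f2)) \<in> span_rel C W A B"
  shows "((A2, w2, f2), (A1, w1, f1)) \<in> span_rel C W A B"
proof -
  obtain A3 v1 v2 where *: "(A1, w1, f1) \<in> spans C W A B" "(A2, w2, f2) \<in> spans C W A B"
    "v1 \<in> hom C A3 A1" "v2 \<in> hom C A3 A2" "w1 \<cdot> v1 \<in> W" "w1 \<cdot> v1 = w2 \<cdot> v2" "f1 \<cdot> v1 = f2 \<cdot> v2"
    using assms by (rule span_relE)
  show ?thesis
    using *(5) by (intro span_relI[OF *(2,1,4,3)]) (simp_all add: *(6,7))
qed

text \<open>The two witnesses are joined over the middle span: \<open>common_lift\<close> completes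
  the cospan formed by \<open>a2\<close> and \<open>b2\<close>, and the outer legs are composed with
  the result.\<close>

lemma span_rel_trans:
  assumes "((A1, w1, f1), (A2, w2, f2)) \<in> span_rel C W A B"
    and "((A2, w2, f2), (A3, w3, f3)) \<in> span_rel C W A B"
  shows "((A1, w1, f1), (A3, w3, f3)) \<in> span_rel C W A B"
proof -
  obtain D a1 a2 where a: "(A1, w1, f1) \<in> spans C W A B" "(A2, w2, f2) \<in> spans C W A B"
    "a1 \<in> hom C D A1" "a2 \<in> hom C D A2" "w1 \<cdot> a1 \<in> W" "w1 \<cdot> a1 = w2 \<cdot> a2" "f1 \<cdot> a1 = f2 \<cdot> a2"
    using assms(1) by (rule span_relE)
  obtain E b2 b3 where b: "(A2, w2, f2) \<in> spans C W A B" "(A3, w3, f3) \<in> spans C W A B"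
    "b2 \<in> hom C E A2" "b3 \<in> hom C E A3" "w2 \<cdot> b2 \<in> W" "w2 \<cdot> b2 = w3 \<cdot> b3" "f2 \<cdot> b2 = f3 \<cdot> b3"
    using assms(2) by (rule span_relE)
  note s1 = spansD[OF a(1)] and s2 = spansD[OF a(2)] and s3 = spansD[OF b(2)]
  have "w2 \<cdot> a2 \<in> W" using a by simp
  then obtain F s t where st: "s \<in> W" "s \<in> hom C F E" "t \<in> hom C F D" "b2 \<cdot> s = a2 \<cdot> t"
    using common_lift[OF s2(1,2) a(4) _ b(3)] by blast
  have w: "w1 \<cdot> (a1 \<cdot> t) = w2 \<cdot> (a2 \<cdot> t)" "w2 \<cdot> (b2 \<cdot> s) = w3 \<cdot> (b3 \<cdot> s)"
    using Comp_eq_extend[OF a(6) a(3) s1(2) a(4) s2(2) st(3)]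
      Comp_eq_extend[OF b(6) b(3) s2(2) b(4) s3(2) st(2)] by auto
  have f: "f1 \<cdot> (a1 \<cdot> t) = f2 \<cdot> (a2 \<cdot> t)" "f2 \<cdot> (b2 \<cdot> s) = f3 \<cdot> (b3 \<cdot> s)"
    using Comp_eq_extend[OF a(7) a(3) s1(3) a(4) s2(3) st(3)]
      Comp_eq_extend[OF b(7) b(3) s2(3) b(4) s3(3) st(2)] by auto
  show ?thesis
  proof (rule span_relI[OF a(1) b(2)])
    show "a1 \<cdot> t \<in> hom C F A1" "b3 \<cdot> s \<in> hom C F A3" using Comp_in_hom a b st by blast+
    \<comment> \<open>Membership is read off at the other end: the composite equals
      \<open>w2 \<cdot> b2 \<cdot> s\<close>, where \<open>w2 \<cdot> b2\<close> and
      \<open>s\<close> are in \<open>W\<close>.\<close>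
    show "w1 \<cdot> a1 \<cdot> t \<in> W"
      using W_Comp3[OF b(5) st(1,2) b(3) s2(2)] w st(4) by simp
  qed (use w f st(4) in auto)
qed

lemma equiv_span_rel: "equiv (spans C W A B) (span_rel C W A B)"
proof (rule equivI)
  show "refl_on (spans C W A B) (span_rel C W A B)"
    using span_rel_refl by (auto simp: refl_on_def)
  show "sym (span_rel C W A B)"
    using span_rel_sym by (fastforce simp: sym_def)
  show "trans (span_rel C W A B)"
    using span_rel_trans by (fastforce simp: trans_def)
qed (auto simp: span_rel_def)

section \<open>Classes of spans and changes of representative\<close>

lemma frac_eq_Image:
  "(A', w, f) \<in> spans C W A B \<Longrightarrow> frac C W A' w f = span_rel C W A B `` {(A', w, f)}"
  by (auto simp: frac_def spans_def hom_def)

lemma frac_self: "(A', w, f) \<in> spans C W A B \<Longrightarrow> (A', w, f) \<in> frac C W A' w f"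
  using span_rel_refl by (simp add: frac_eq_Image)

lemma mem_frac_spans:
  "(A', w, f) \<in> spans C W A B \<Longrightarrow> x \<in> frac C W A' w f \<Longrightarrow> x \<in> spans C W A B"
  by (auto simp: frac_eq_Image span_rel_def)

lemma frac_eq_iff:
  assumes "(A1, w1, f1) \<in> spans C W A B" "(A2, w2, f2) \<in> spans C W A B"
  shows "frac C W A1 w1 f1 = frac C W A2 w2 f2 \<longleftrightarrow>
    ((A1, w1, f1), (A2, w2, f2)) \<in> span_rel C W A B"
  using eq_equiv_class_iff[OF equiv_span_rel assms] assms by (simp add: frac_eq_Image)

lemma frac_eqI:
  assumes "(A1, w1, f1) \<in> spans C W A B" "(A2, w2, f2) \<in> spans C W A B"
    and "v1 \<in> hom C A3 A1" "v2 \<in> hom C A3 A2" "w1 \<cdot> v1 \<in> W" "w1 \<cdot> v1 = w2 \<cdot> v2" "f1 \<cdot> v1 = f2 \<cdot> v2"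
  shows "frac C W A1 w1 f1 = frac C W A2 w2 f2"
  using frac_eq_iff[OF assms(1,2)] span_relI[OF assms] by simp

text \<open>The legs \<open>id E\<close> and \<open>k\<close> witness the equivalence. This is the
  basic change of representative; \<open>k\<close> itself may lie outside \<open>W\<close>.\<close>

lemma frac_refine:
  assumes "(A', w, f) \<in> spans C W A B" "k \<in> hom C E A'" "w \<cdot> k \<in> W"
  shows "(E, w \<cdot> k, f \<cdot> k) \<in> spans C W A B" "frac C W E (w \<cdot> k) (f \<cdot> k) = frac C W A' w f"
proof -
  note s = spansD[OF assms(1)]
  show *: "(E, w \<cdot> k, f \<cdot> k) \<in> spans C W A B"
    using assms s by (auto intro!: spansI Comp_in_hom)
  note [simp] = s(1) homD[OF s(2)] homD[OF s(3)] homD[OF assms(2)]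
  show "frac C W E (w \<cdot> k) (f \<cdot> k) = frac C W A' w f"
    by (rule frac_eqI[OF * assms(1), of "\<i>\<d> E" E k]) (use assms in \<open>auto intro!: homI\<close>)
qed

text \<open>The definition of \<open>span_rel\<close> only puts \<open>w1 \<cdot> u\<close> into \<open>W\<close>; applying (CF3) and (CF4) to \<open>w1\<close>
  and \<open>w1 \<cdot> u\<close> improves \<open>u\<close> to an element of \<open>W\<close>, as condition (e) demands.\<close>

lemma frac_eqE:
  assumes "(A1, w1, f1) \<in> spans C W A B" "(A2, w2, f2) \<in> spans C W A B"
    and "frac C W A1 w1 f1 = frac C W A2 w2 f2"
  obtains F u u' where "u \<in> W" "u \<in> hom C F A1" "u' \<in> hom C F A2"
    "w1 \<cdot> u = w2 \<cdot> u'" "f1 \<cdot> u = f2 \<cdot> u'"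
proof -
  obtain A3 v1 v2 where v: "v1 \<in> hom C A3 A1" "v2 \<in> hom C A3 A2" "w1 \<cdot> v1 \<in> W"
    "w1 \<cdot> v1 = w2 \<cdot> v2" "f1 \<cdot> v1 = f2 \<cdot> v2"
    using frac_eq_iff[OF assms(1,2)] assms(3) by (auto elim: span_relE)
  note s1 = spansD[OF assms(1)] and s2 = spansD[OF assms(2)]
  note [simp] = homD[OF s1(2)]
  \<comment> \<open>Lifting the identity of \<open>A1\<close> through \<open>v1\<close> produces
    \<open>s\<close> in \<open>W\<close> that factors through \<open>v1\<close>.\<close>
  obtain F s t where st: "s \<in> W" "s \<in> hom C F A1" "t \<in> hom C F A3" "\<i>\<d> A1 \<cdot> s = v1 \<cdot> t"
    using common_lift[OF s1(1,2) v(1,3) Id_in_hom[OF homD(4)[OF s1(2)]]] .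
  have s: "s = v1 \<cdot> t" using st(4) Id_Comp[OF st(2)] by simp
  show thesis
  proof (rule that[OF st(1,2)])
    show "v2 \<cdot> t \<in> hom C F A2" using Comp_in_hom st v by blast
    show "w1 \<cdot> s = w2 \<cdot> v2 \<cdot> t" "f1 \<cdot> s = f2 \<cdot> v2 \<cdot> t"
      unfolding s
      using Comp_eq_extend[OF v(4,1) s1(2) v(2) s2(2) st(3)]
        Comp_eq_extend[OF v(5,1) s1(3) v(2) s2(3) st(3)] by auto
  qed
qed

text \<open>With equal denominators the two witnessing legs agree after \<open>w\<close>, so (CF4)
  makes them equal after a further refinement. Equations between fractions thus become equations in
  \<open>C\<close>.\<close>

lemma frac_eq_same_denomE:
  assumes "(A', w, f) \<in> spans C W A B" "(A', w, f') \<in> spans C W A B"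
    and "frac C W A' w f = frac C W A' w f'"
  obtains F u where "u \<in> W" "u \<in> hom C F A'" "f \<cdot> u = f' \<cdot> u"
proof -
  note s = spansD[OF assms(1)] and s' = spansD[OF assms(2)]
  obtain E u u' where u: "u \<in> W" "u \<in> hom C E A'" "u' \<in> hom C E A'"
    "w \<cdot> u = w \<cdot> u'" "f \<cdot> u = f' \<cdot> u'"
    using frac_eqE[OF assms] by blast
  obtain F r where r: "r \<in> W" "r \<in> hom C F E" "u \<cdot> r = u' \<cdot> r"
    using CF4[OF s(1,2) u(2,3,4)] by blast
  show thesis
  proof (rule that[of "u \<cdot> r"])
    show "u \<cdot> r \<in> W" using W_Comp[OF r(1) u(1) r(2) u(2)] .
    show "u \<cdot> r \<in> hom C F A'" using Comp_in_hom r u by blast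
    show "f \<cdot> u \<cdot> r = f' \<cdot> u \<cdot> r"
      using Comp_eq_extend[OF u(5,2) s(3) u(3) s'(3) r(2)] r(3) by simp
  qed
qed

lemma common_denominator:
  assumes "(A1, w1, f1) \<in> spans C W A B1" "(A2, w2, f2) \<in> spans C W A B2"
  obtains D w g1 g2 where "(D, w, g1) \<in> spans C W A B1" "(D, w, g2) \<in> spans C W A B2"
    "frac C W A1 w1 f1 = frac C W D w g1" "frac C W A2 w2 f2 = frac C W D w g2"
proof -
  note s1 = spansD[OF assms(1)] and s2 = spansD[OF assms(2)]
  obtain E s t where st: "s \<in> W" "s \<in> hom C E A2" "t \<in> hom C E A1" "w2 \<cdot> s = w1 \<cdot> t"
    using CF3[OF s1(1,2) s2(2)] by blast
  have W2: "w2 \<cdot> s \<in> W" using W_Comp[OF st(1) s2(1) st(2) s2(2)] .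
  \<comment> \<open>Here \<open>t\<close> may lie outside \<open>W\<close>, but
    \<open>w1 \<cdot> t\<close> is the new denominator \<open>w2 \<cdot> s\<close>, as
    \<open>frac_refine\<close> demands.\<close>
  then have W1: "w1 \<cdot> t \<in> W" using st by simp
  show thesis
    using that frac_refine[OF assms(1) st(3) W1] frac_refine[OF assms(2) st(2) W2] st(4) by metis
qed

section \<open>The category of fractions\<close>

text \<open>Only \<open>w \<cdot> k\<close>, not \<open>k\<close>, is required to lie in \<open>W\<close>: the legs that witness \<open>span_rel\<close>
  need not lie in \<open>W\<close> either, so they can be composed with such completions.\<close>

definition completion where
  "completion A' w f B' v E k l \<longleftrightarrow>
     k \<in> hom C E A' \<and> l \<in> hom C E B' \<and> w \<cdot> k \<in> W \<and> f \<cdot> k = v \<cdot> l"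

lemma completion_span:
  assumes "(A', w, f) \<in> spans C W A B" "(B', v, g) \<in> spans C W B D"
    and "completion A' w f B' v E k l"
  shows "(E, w \<cdot> k, g \<cdot> l) \<in> spans C W A D"
  using assms Comp_in_hom unfolding completion_def spans_def by blast

text \<open>\<open>common_lift\<close> aligns the legs \<open>k1\<close> and \<open>k2\<close>; the
  legs \<open>l1\<close> and \<open>l2\<close> then agree after \<open>v\<close>, and (CF4) for
  \<open>v\<close> makes them agree after one more refinement.\<close>

lemma completion_unique:
  assumes X: "(A', w, f) \<in> spans C W A B" and Y: "(B', v, g) \<in> spans C W B D"
    and c1: "completion A' w f B' v E1 k1 l1" and c2: "completion A' w f B' v E2 k2 l2"
  shows "frac C W E1 (w \<cdot> k1) (g \<cdot> l1) = frac C W E2 (w \<cdot> k2) (g \<cdot> l2)"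
proof -
  note x = spansD[OF X] and y = spansD[OF Y]
  have k1: "k1 \<in> hom C E1 A'" "l1 \<in> hom C E1 B'" "w \<cdot> k1 \<in> W" "f \<cdot> k1 = v \<cdot> l1"
    and k2: "k2 \<in> hom C E2 A'" "l2 \<in> hom C E2 B'" "w \<cdot> k2 \<in> W" "f \<cdot> k2 = v \<cdot> l2"
    using c1 c2 unfolding completion_def by auto
  obtain E s t where st: "s \<in> W" "s \<in> hom C E E2" "t \<in> hom C E E1" "k2 \<cdot> s = k1 \<cdot> t"
    using common_lift[OF x(1,2) k1(1,3) k2(1)] by blast
  have "v \<cdot> (l2 \<cdot> s) = v \<cdot> (l1 \<cdot> t)"
    using Comp_eq_extend[OF k1(4,1) x(3) k1(2) y(2) st(3)]
      Comp_eq_extend[OF k2(4,1) x(3) k2(2) y(2) st(2)] st(4) by simp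
  then obtain F r where r: "r \<in> W" "r \<in> hom C F E" "(l2 \<cdot> s) \<cdot> r = (l1 \<cdot> t) \<cdot> r"
    using CF4[OF y(1,2) Comp_in_hom[OF st(2) k2(2)] Comp_in_hom[OF st(3) k1(2)]] by blast
  note [simp] = homD[OF x(2)] homD[OF x(3)] homD[OF y(2)] homD[OF y(3)] homD[OF k1(1)] homD[OF k1(2)]
    homD[OF k2(1)] homD[OF k2(2)] homD[OF st(2)] homD[OF st(3)] homD[OF r(2)]
  have kr: "k2 \<cdot> s \<cdot> r = k1 \<cdot> t \<cdot> r" using arg_cong[OF st(4), of "\<lambda>x. x \<cdot> r"] by simp
  have lr: "l2 \<cdot> s \<cdot> r = l1 \<cdot> t \<cdot> r" using r(3) by simp
  have "s \<cdot> r \<in> W" using W_Comp[OF r(1) st(1) r(2) st(2)] .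
  then have "w \<cdot> (k2 \<cdot> (s \<cdot> r)) \<in> W"
    using W_Comp3[OF k2(3) _ Comp_in_hom[OF r(2) st(2)] k2(1) x(2)] by simp
  then show ?thesis
    by (intro frac_eqI[OF completion_span[OF X Y c1] completion_span[OF X Y c2],
          of "t \<cdot> r" F "s \<cdot> r"]) (auto intro!: homI simp: kr lr)
qed

text \<open>One square over the witnesses of both equivalences yields a completion for each of the
  two pairs of representatives, with equal composite spans. Uniqueness of completions for each pair
  then links the two sides.\<close>

lemma completion_well_defined:
  assumes X1: "(A1, w1, f1) \<in> spans C W A B" and X2: "(A2, w2, f2) \<in> spans C W A B"
    and Y1: "(B1, v1, g1) \<in> spans C W B D" and Y2: "(B2, v2, g2) \<in> spans C W B D"
    and X: "frac C W A1 w1 f1 = frac C W A2 w2 f2" and Y: "frac C W B1 v1 g1 = frac C W B2 v2 g2"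
    and c1: "completion A1 w1 f1 B1 v1 E1 k1 l1" and c2: "completion A2 w2 f2 B2 v2 E2 k2 l2"
  shows "frac C W E1 (w1 \<cdot> k1) (g1 \<cdot> l1) = frac C W E2 (w2 \<cdot> k2) (g2 \<cdot> l2)"
proof -
  note x1 = spansD[OF X1] and y1 = spansD[OF Y1] and x2 = spansD[OF X2] and y2 = spansD[OF Y2]
  obtain A3 a1 a2 where a: "a1 \<in> hom C A3 A1" "a2 \<in> hom C A3 A2" "w1 \<cdot> a1 \<in> W"
    "w1 \<cdot> a1 = w2 \<cdot> a2" "f1 \<cdot> a1 = f2 \<cdot> a2"
    using frac_eq_iff[OF X1 X2] X by (auto elim: span_relE)
  obtain B3 b1 b2 where b: "b1 \<in> hom C B3 B1" "b2 \<in> hom C B3 B2" "v1 \<cdot> b1 \<in> W"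
    "v1 \<cdot> b1 = v2 \<cdot> b2" "g1 \<cdot> b1 = g2 \<cdot> b2"
    using frac_eq_iff[OF Y1 Y2] Y by (auto elim: span_relE)
  \<comment> \<open>(CF3) is applied to the whole composite \<open>v1 \<cdot> b1\<close>, since only
    that is known to be in \<open>W\<close>.\<close>
  obtain E s t where st: "s \<in> W" "s \<in> hom C E A3" "t \<in> hom C E B3"
      "(f1 \<cdot> a1) \<cdot> s = (v1 \<cdot> b1) \<cdot> t"
    using CF3[OF b(3) Comp_in_hom[OF b(1) y1(2)] Comp_in_hom[OF a(1) x1(3)]] by blast
  then have st': "(f2 \<cdot> a2) \<cdot> s = (v2 \<cdot> b2) \<cdot> t" using a b by simp
  note [simp] = homD[OF x1(2)] homD[OF x1(3)] homD[OF y1(2)] homD[OF y1(3)]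
    homD[OF x2(2)] homD[OF x2(3)] homD[OF y2(2)] homD[OF y2(3)] homD[OF a(1)] homD[OF a(2)]
    homD[OF b(1)] homD[OF b(2)] homD[OF st(2)] homD[OF st(3)]
  have e: "w1 \<cdot> a1 \<cdot> s = w2 \<cdot> a2 \<cdot> s" "g1 \<cdot> b1 \<cdot> t = g2 \<cdot> b2 \<cdot> t"
    using arg_cong[OF a(4), of "\<lambda>x. x \<cdot> s"] arg_cong[OF b(5), of "\<lambda>x. x \<cdot> t"] by simp_all
  have W1: "w1 \<cdot> a1 \<cdot> s \<in> W" using W_Comp3[OF a(3) st(1,2) a(1) x1(2)] .
  have "completion A1 w1 f1 B1 v1 E (a1 \<cdot> s) (b1 \<cdot> t)"
    unfolding completion_def using W1 st(4) by (auto intro!: homI)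
  from completion_unique[OF X1 Y1 c1 this]
  have 1: "frac C W E1 (w1 \<cdot> k1) (g1 \<cdot> l1) = frac C W E (w1 \<cdot> a1 \<cdot> s) (g1 \<cdot> b1 \<cdot> t)" .
  have "completion A2 w2 f2 B2 v2 E (a2 \<cdot> s) (b2 \<cdot> t)"
    unfolding completion_def using W1 st' e by (auto intro!: homI)
  from completion_unique[OF X2 Y2 c2 this] 1 e show ?thesis by simp
qed

text \<open>The extra fact \<open>k \<in> W\<close> is what the description in
  \<open>frac_comp\<close> asks for, and it allows (CF3) to be applied to \<open>k\<close>.\<close>

lemma completion_exists:
  assumes "(A', w, f) \<in> spans C W A B" "(B', v, g) \<in> spans C W B D"
  obtains E k l where "completion A' w f B' v E k l" "k \<in> W"
proof -
  note x = spansD[OF assms(1)] and y = spansD[OF assms(2)]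
  obtain E k l where "k \<in> W" "k \<in> hom C E A'" "l \<in> hom C E B'" "f \<cdot> k = v \<cdot> l"
    using CF3[OF y(1,2) x(3)] by blast
  with that show thesis
    using W_Comp[OF _ x(1) _ x(2)] unfolding completion_def by blast
qed

text \<open>A class contains its own representative, and every member shows the source and target as
  codomains of its legs. Hence \<open>Dom\<close> and \<open>Cod\<close> of a fraction are
  determined.\<close>

lemma frac_eq_same_type:
  assumes "(A1, w1, f1) \<in> spans C W A B" "(A2, w2, f2) \<in> spans C W A' B'"
    and "frac C W A1 w1 f1 = frac C W A2 w2 f2"
  shows "A' = A" "B' = B"
  using mem_frac_spans[OF assms(1)] frac_self[OF assms(2)] assms(2,3)
  by (auto simp: spans_def hom_def)

lemma frac_comp_eq:
  assumes X: "(A', w, f) \<in> spans C W A B" and Y: "(B', v, g) \<in> spans C W B D"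
    and c: "completion A' w f B' v E k l"
  shows "frac_comp C W (frac C W B' v g) (frac C W A' w f) = frac C W E (w \<cdot> k) (g \<cdot> l)"
  unfolding frac_comp_def
proof (rule the_equality)
  \<comment> \<open>The given \<open>k\<close> may lie outside \<open>W\<close>, while the
    description requires a leg in \<open>W\<close>; another completion supplies it and yields the
    same class.\<close>
  obtain E' k' l' where c': "completion A' w f B' v E' k' l'" "k' \<in> W"
    using completion_exists[OF X Y] .
  show "\<exists>Aa Ba Da A'a wa fa B'a va ga A'' v' f'.
       (A'a, wa, fa) \<in> spans C W Aa Ba \<and> frac C W A' w f = frac C W A'a wa fa \<and>
       (B'a, va, ga) \<in> spans C W Ba Da \<and> frac C W B' v g = frac C W B'a va ga \<and>
       v' \<in> W \<and> v' \<in> hom C A'' A'a \<and> f' \<in> hom C A'' B'a \<and> fa \<cdot> v' = va \<cdot> f' \<and>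
       frac C W E (w \<cdot> k) (g \<cdot> l) = frac C W A'' (wa \<cdot> v') (ga \<cdot> f')"
    using X Y c' completion_unique[OF X Y c c'(1)] unfolding completion_def by blast
next
  fix Z
  assume "\<exists>Aa Ba Da A'a wa fa B'a va ga A'' v' f'.
       (A'a, wa, fa) \<in> spans C W Aa Ba \<and> frac C W A' w f = frac C W A'a wa fa \<and>
       (B'a, va, ga) \<in> spans C W Ba Da \<and> frac C W B' v g = frac C W B'a va ga \<and>
       v' \<in> W \<and> v' \<in> hom C A'' A'a \<and> f' \<in> hom C A'' B'a \<and> fa \<cdot> v' = va \<cdot> f' \<and>
       Z = frac C W A'' (wa \<cdot> v') (ga \<cdot> f')"
  then obtain Aa Ba Da A2 w2 f2 B2 v2 g2 E2 k2 l2 where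
    X2: "(A2, w2, f2) \<in> spans C W Aa Ba" "frac C W A' w f = frac C W A2 w2 f2" and
    Y2: "(B2, v2, g2) \<in> spans C W Ba Da" "frac C W B' v g = frac C W B2 v2 g2" and
    k2: "k2 \<in> W" "k2 \<in> hom C E2 A2" "l2 \<in> hom C E2 B2" "f2 \<cdot> k2 = v2 \<cdot> l2" and
    Z: "Z = frac C W E2 (w2 \<cdot> k2) (g2 \<cdot> l2)"
    by blast
  \<comment> \<open>The description quantifies over source, middle and target objects, so these are
    first identified with the given ones.\<close>
  have eqs: "Aa = A" "Ba = B" "Da = D"
    using frac_eq_same_type[OF X X2] frac_eq_same_type[OF Y Y2] by auto
  note x2 = spansD[OF X2(1)]
  have "completion A2 w2 f2 B2 v2 E2 k2 l2"
    unfolding completion_def using k2 W_Comp[OF k2(1) x2(1) k2(2) x2(2)] by blast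
  then show "Z = frac C W E (w \<cdot> k) (g \<cdot> l)"
    using completion_well_defined[OF X _ Y _ X2(2) Y2(2) c] X2(1) Y2(1) eqs Z by simp
qed

section \<open>Hom-sets and special composites\<close>

lemma frac_hom_iff:
  "X \<in> frac_hom C W A B \<longleftrightarrow> (\<exists>A' w f. (A', w, f) \<in> spans C W A B \<and> X = frac C W A' w f)"
  unfolding frac_hom_def quotient_def by (fastforce simp: frac_eq_Image)

lemma frac_hom_same_type:
  "X \<in> frac_hom C W A B \<Longrightarrow> X \<in> frac_hom C W A' B' \<Longrightarrow> A' = A \<and> B' = B"
  unfolding frac_hom_iff by (metis frac_eq_same_type)

lemma Obj_fractions [simp]: "Obj (fractions C W) = Obj C"
  and Comp_fractions [simp]: "Comp (fractions C W) = frac_comp C W"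
  and Id_fractions: "Id (fractions C W) A = frac C W A (\<i>\<d> A) (\<i>\<d> A)"
  by (simp_all add: fractions_def)

lemma Dom_Cod_fractions:
  assumes "X \<in> frac_hom C W A B"
  shows "Dom (fractions C W) X = A" "Cod (fractions C W) X = B"
proof -
  show "Dom (fractions C W) X = A"
    using assms by (auto simp: fractions_def intro!: the_equality dest: frac_hom_same_type[OF assms])
  show "Cod (fractions C W) X = B"
    using assms by (auto simp: fractions_def intro!: the_equality dest: frac_hom_same_type[OF assms])
qed

lemma Mor_fractions:
  "X \<in> Mor (fractions C W) \<longleftrightarrow> (\<exists>A B. X \<in> frac_hom C W A B)"
proof
  assume "\<exists>A B. X \<in> frac_hom C W A B"
  then obtain A B where X: "X \<in> frac_hom C W A B" by blast
  then obtain A' w f where s: "(A', w, f) \<in> spans C W A B" unfolding frac_hom_iff by blast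
  show "X \<in> Mor (fractions C W)"
    using X homD(5)[OF spansD(2)[OF s]] homD(5)[OF spansD(3)[OF s]] by (auto simp: fractions_def)
qed (auto simp: fractions_def)

lemma hom_fractions: "hom (fractions C W) A B = frac_hom C W A B"
proof (intro equalityI subsetI)
  fix X assume "X \<in> hom (fractions C W) A B"
  then obtain A' B' where X: "X \<in> frac_hom C W A' B'"
    and t: "Dom (fractions C W) X = A" "Cod (fractions C W) X = B"
    unfolding hom_def Mor_fractions by blast
  then show "X \<in> frac_hom C W A B" using Dom_Cod_fractions[OF X] by simp
next
  fix X assume X: "X \<in> frac_hom C W A B"
  then show "X \<in> hom (fractions C W) A B"
    using Dom_Cod_fractions[OF X] unfolding hom_def Mor_fractions by blast
qed

lemma hom_fractionsE:
  assumes "X \<in> hom (fractions C W) A B"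
  obtains A' w f where "(A', w, f) \<in> spans C W A B" "X = frac C W A' w f"
  using assms by (auto simp: hom_fractions frac_hom_iff)

lemma frac_in_hom: "(A', w, f) \<in> spans C W A B \<Longrightarrow> frac C W A' w f \<in> hom (fractions C W) A B"
  by (auto simp: hom_fractions frac_hom_iff)

text \<open>The square over an identity denominator is completed by \<open>id A'\<close> and
  \<open>f\<close>, so the denominator \<open>w\<close> survives unchanged.\<close>

lemma frac_comp_mor_frac:
  assumes X: "(A', w, f) \<in> spans C W A B" and g: "g \<in> hom C B D"
  shows "frac_comp C W (frac C W B (\<i>\<d> B) g) (frac C W A' w f) = frac C W A' w (g \<cdot> f)"
proof -
  note x = spansD[OF X]
  note [simp] = x(1) homD[OF x(2)] homD[OF x(3)] homD[OF g]
  have "completion A' w f B (\<i>\<d> B) A' (\<i>\<d> A') f"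
    unfolding completion_def by (auto intro!: homI)
  from frac_comp_eq[OF X _ this, of g D] show ?thesis
    using g by (simp add: spans_def CF1 Id_in_hom)
qed

text \<open>Numerator and denominator \<open>v\<close> cancel, through identity legs. The case
  \<open>v = id\<close> splits off a denominator \<open>w\<close>; the case \<open>w = id\<close>
  removes the denominator \<open>v\<close>.\<close>

lemma frac_comp_frac_W:
  assumes X: "(B', v, g) \<in> spans C W B D" and w: "w \<in> W" "w \<in> hom C B' A"
  shows "frac_comp C W (frac C W B' v g) (frac C W B' w v) = frac C W B' w g"
proof -
  note x = spansD[OF X]
  note [simp] = x(1) w(1) homD[OF x(2)] homD[OF x(3)] homD[OF w(2)]
  have "completion B' w v B' v B' (\<i>\<d> B') (\<i>\<d> B')"
    unfolding completion_def by (auto intro!: homI)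
  from frac_comp_eq[OF _ X this, of A] show ?thesis
    using x w by (simp add: spans_def)
qed

lemma frac_W_W:
  assumes "w \<in> W" "w \<in> hom C A' A"
  shows "frac C W A' w w = frac C W A (\<i>\<d> A) (\<i>\<d> A)"
proof -
  note [simp] = assms(1) homD[OF assms(2)]
  show ?thesis
    by (rule frac_eqI[where A = A and B = A and ?v1.0 = "\<i>\<d> A'" and ?A3.0 = A' and ?v2.0 = w])
      (auto intro!: homI simp: spans_def CF1)
qed

lemma spans_Id: "f \<in> hom C A B \<Longrightarrow> (A, \<i>\<d> A, f) \<in> spans C W A B"
  by (auto simp: spans_def CF1 Id_in_hom homD)

section \<open>The category axioms for fractions\<close>

lemma frac_comp_in_hom:
  assumes "X \<in> hom (fractions C W) A B" "Y \<in> hom (fractions C W) B D"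
  shows "frac_comp C W Y X \<in> hom (fractions C W) A D"
proof -
  obtain A' w f where X: "(A', w, f) \<in> spans C W A B" "X = frac C W A' w f"
    using assms(1) by (rule hom_fractionsE)
  obtain B' v g where Y: "(B', v, g) \<in> spans C W B D" "Y = frac C W B' v g"
    using assms(2) by (rule hom_fractionsE)
  obtain E k l where c: "completion A' w f B' v E k l"
    using completion_exists[OF X(1) Y(1)] .
  show ?thesis
    using frac_comp_eq[OF X(1) Y(1) c] frac_in_hom[OF completion_span[OF X(1) Y(1) c]] X Y by simp
qed

lemma frac_comp_assoc:
  assumes "X \<in> hom (fractions C W) A B" "Y \<in> hom (fractions C W) B D"
    and "Z \<in> hom (fractions C W) D E"
  shows "frac_comp C W (frac_comp C W Z Y) X = frac_comp C W Z (frac_comp C W Y X)"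
proof -
  obtain A' w f where X: "(A', w, f) \<in> spans C W A B" "X = frac C W A' w f"
    using assms(1) by (rule hom_fractionsE)
  obtain B' v g where Y: "(B', v, g) \<in> spans C W B D" "Y = frac C W B' v g"
    using assms(2) by (rule hom_fractionsE)
  obtain D' u h where Z: "(D', u, h) \<in> spans C W D E" "Z = frac C W D' u h"
    using assms(3) by (rule hom_fractionsE)
  note x = spansD[OF X(1)] and y = spansD[OF Y(1)] and z = spansD[OF Z(1)]
  obtain F k l where c1: "completion A' w f B' v F k l" "k \<in> W"
    using completion_exists[OF X(1) Y(1)] .
  then have k: "k \<in> hom C F A'" "l \<in> hom C F B'" "w \<cdot> k \<in> W" "f \<cdot> k = v \<cdot> l"
    unfolding completion_def by auto
  obtain G m n where c2: "completion B' v g D' u G m n" "m \<in> W"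
    using completion_exists[OF Y(1) Z(1)] .
  then have m: "m \<in> hom C G B'" "n \<in> hom C G D'" "v \<cdot> m \<in> W" "g \<cdot> m = u \<cdot> n"
    unfolding completion_def by auto
  \<comment> \<open>The completions for \<open>Y\<close> after \<open>X\<close> and for
    \<open>Z\<close> after \<open>Y\<close> are joined over \<open>B'\<close>, using
    \<open>m \<in> W\<close>. The resulting \<open>H\<close> computes both bracketings by the same
    span.\<close>
  obtain H s t where st: "s \<in> W" "s \<in> hom C H F" "t \<in> hom C H G" "l \<cdot> s = m \<cdot> t"
    using CF3[OF c2(2) m(1) k(2)] by blast
  note [simp] = homD[OF x(2)] homD[OF x(3)] homD[OF y(2)] homD[OF y(3)] homD[OF z(2)] homD[OF z(3)]
    homD[OF k(1)] homD[OF k(2)] homD[OF m(1)] homD[OF m(2)] homD[OF st(2)] homD[OF st(3)]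
  have YX: "frac_comp C W Y X = frac C W F (w \<cdot> k) (g \<cdot> l)"
    using frac_comp_eq[OF X(1) Y(1) c1(1)] X(2) Y(2) by simp
  have ZY: "frac_comp C W Z Y = frac C W G (v \<cdot> m) (h \<cdot> n)"
    using frac_comp_eq[OF Y(1) Z(1) c2(1)] Y(2) Z(2) by simp
  have W: "w \<cdot> k \<cdot> s \<in> W" using W_Comp3[OF k(3) st(1,2) k(1) x(2)] .
  have "g \<cdot> l \<cdot> s = u \<cdot> n \<cdot> t"
    using Comp_eq_extend[OF m(4,1) y(3) m(2) z(2) st(3)] st(4) by simp
  then have "completion F (w \<cdot> k) (g \<cdot> l) D' u H s (n \<cdot> t)"
    unfolding completion_def using W by (auto intro!: homI)
  from frac_comp_eq[OF completion_span[OF X(1) Y(1) c1(1)] Z(1) this]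
  have 1: "frac_comp C W Z (frac_comp C W Y X) = frac C W H (w \<cdot> k \<cdot> s) (h \<cdot> n \<cdot> t)"
    using YX Z(2) by simp
  have "f \<cdot> k \<cdot> s = v \<cdot> m \<cdot> t"
    using Comp_eq_extend[OF k(4,1) x(3) k(2) y(2) st(2)] st(4) by simp
  then have "completion A' w f G (v \<cdot> m) H (k \<cdot> s) t"
    unfolding completion_def using W by (auto intro!: homI)
  from frac_comp_eq[OF X(1) completion_span[OF Y(1) Z(1) c2(1)] this]
  show ?thesis using 1 ZY X(2) by simp
qed

lemma category_fractions: "category (fractions C W)"
proof
  fix X assume "X \<in> Mor (fractions C W)"
  then obtain A B where X: "X \<in> frac_hom C W A B" by (auto simp: Mor_fractions)
  then have "A \<in> Obj C" "B \<in> Obj C" by (auto simp: frac_hom_iff spans_def dest: homD(4,5))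
  then show "Dom (fractions C W) X \<in> Obj (fractions C W)" "Cod (fractions C W) X \<in> Obj (fractions C W)"
    by (simp_all add: Dom_Cod_fractions[OF X])
next
  fix A assume "A \<in> Obj (fractions C W)"
  then show "Id (fractions C W) A \<in> hom (fractions C W) A A"
    by (simp add: Id_fractions frac_in_hom spans_Id Id_in_hom)
next
  fix X A B assume "X \<in> hom (fractions C W) A B"
  then obtain A' w f where X: "(A', w, f) \<in> spans C W A B" "X = frac C W A' w f"
    by (rule hom_fractionsE)
  note x = spansD[OF X(1)]
  note [simp] = homD[OF x(2)] homD[OF x(3)]
  have [simp]: "w \<in> W" using x by simp
  show "X \<cdot>\<^bsub>fractions C W\<^esub> Id (fractions C W) A = X"
    using frac_comp_frac_W[OF X(1) x(1,2)] frac_W_W[OF x(1,2)] X(2) by (simp add: Id_fractions)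
  show "Id (fractions C W) B \<cdot>\<^bsub>fractions C W\<^esub> X = X"
    using frac_comp_mor_frac[OF X(1) Id_in_hom] X(2) by (simp add: Id_fractions)
next
  fix X Y A B D assume "X \<in> hom (fractions C W) A B" "Y \<in> hom (fractions C W) B D"
  then show "Y \<cdot>\<^bsub>fractions C W\<^esub> X \<in> hom (fractions C W) A D"
    unfolding Comp_fractions by (rule frac_comp_in_hom)
next
  fix X Y Z A B D E
  assume "X \<in> hom (fractions C W) A B" "Y \<in> hom (fractions C W) B D" "Z \<in> hom (fractions C W) D E"
  then show "(Z \<cdot>\<^bsub>fractions C W\<^esub> Y) \<cdot>\<^bsub>fractions C W\<^esub> X =
      Z \<cdot>\<^bsub>fractions C W\<^esub> (Y \<cdot>\<^bsub>fractions C W\<^esub> X)"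
    unfolding Comp_fractions by (rule frac_comp_assoc)
qed

text \<open>Elements of \<open>W\<close> become invertible: the composite on \<open>A\<close>
  reduces to the class of \<open>(A', w, w)\<close>, the one on \<open>A'\<close> to that of the
  identity span.\<close>

lemma iso_W:
  assumes "w \<in> W" "w \<in> hom C A' A"
  shows "frac C W A' (\<i>\<d> A') w \<in> hom (fractions C W) A' A"
    and "frac C W A' w (\<i>\<d> A') \<in> hom (fractions C W) A A'"
    and "frac_comp C W (frac C W A' (\<i>\<d> A') w) (frac C W A' w (\<i>\<d> A')) = Id (fractions C W) A"
    and "frac_comp C W (frac C W A' w (\<i>\<d> A')) (frac C W A' (\<i>\<d> A') w) = Id (fractions C W) A'"
proof -
  note [simp] = homD[OF assms(2)]
  have s: "(A', w, \<i>\<d> A') \<in> spans C W A A'"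
    using assms by (simp add: spans_def Id_in_hom)
  show "frac C W A' (\<i>\<d> A') w \<in> hom (fractions C W) A' A"
    using frac_in_hom[OF spans_Id[OF assms(2)]] .
  show "frac C W A' w (\<i>\<d> A') \<in> hom (fractions C W) A A'" using frac_in_hom[OF s] .
  show "frac_comp C W (frac C W A' (\<i>\<d> A') w) (frac C W A' w (\<i>\<d> A')) = Id (fractions C W) A"
    using frac_comp_mor_frac[OF s assms(2)] frac_W_W[OF assms] by (simp add: Id_fractions)
  show "frac_comp C W (frac C W A' w (\<i>\<d> A')) (frac C W A' (\<i>\<d> A') w) = Id (fractions C W) A'"
    using frac_comp_frac_W[OF s CF1 Id_in_hom] by (simp add: Id_fractions)
qed

section \<open>Fiber products of fractions\<close>

text \<open>Over a common denominator \<open>w\<close> the cone equation compares two fractions with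
  the same denominator, so one refinement \<open>u\<close> makes it hold in
  \<open>C\<close>.\<close>

lemma cone_representatives:
  assumes f: "f1 \<in> hom C B1 A" "f2 \<in> hom C B2 A"
    and q: "q1 \<in> hom (fractions C W) X B1" "q2 \<in> hom (fractions C W) X B2"
    and eq: "frac_comp C W (frac C W B1 (\<i>\<d> B1) f1) q1 = frac_comp C W (frac C W B2 (\<i>\<d> B2) f2) q2"
  obtains D u g1 g2 where "(D, u, g1) \<in> spans C W X B1" "(D, u, g2) \<in> spans C W X B2"
    "q1 = frac C W D u g1" "q2 = frac C W D u g2" "f1 \<cdot> g1 = f2 \<cdot> g2"
proof -
  obtain A1 w1 h1 where 1: "(A1, w1, h1) \<in> spans C W X B1" "q1 = frac C W A1 w1 h1"
    using q(1) by (rule hom_fractionsE)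
  obtain A2 w2 h2 where 2: "(A2, w2, h2) \<in> spans C W X B2" "q2 = frac C W A2 w2 h2"
    using q(2) by (rule hom_fractionsE)
  obtain E w k1 k2 where k: "(E, w, k1) \<in> spans C W X B1" "(E, w, k2) \<in> spans C W X B2"
    "q1 = frac C W E w k1" "q2 = frac C W E w k2"
    using common_denominator[OF 1(1) 2(1)] 1(2) 2(2) by metis
  note s1 = spansD[OF k(1)] and s2 = spansD[OF k(2)]
  have "frac C W E w (f1 \<cdot> k1) = frac C W E w (f2 \<cdot> k2)"
    using eq k frac_comp_mor_frac[OF k(1) f(1)] frac_comp_mor_frac[OF k(2) f(2)] by simp
  moreover have "(E, w, f1 \<cdot> k1) \<in> spans C W X A" "(E, w, f2 \<cdot> k2) \<in> spans C W X A"
    using s1 s2 f by (auto simp: spans_def intro: Comp_in_hom)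
  ultimately obtain D u where u: "u \<in> W" "u \<in> hom C D E" "(f1 \<cdot> k1) \<cdot> u = (f2 \<cdot> k2) \<cdot> u"
    using frac_eq_same_denomE by metis
  have wu: "w \<cdot> u \<in> W" using W_Comp[OF u(1) s1(1) u(2) s1(2)] .
  show thesis
  proof (rule that)
    show "f1 \<cdot> k1 \<cdot> u = f2 \<cdot> k2 \<cdot> u"
      using u(3) Comp_assoc[OF u(2) s1(3) f(1)] Comp_assoc[OF u(2) s2(3) f(2)] by simp
  qed (use k frac_refine[OF k(1) u(2) wu] frac_refine[OF k(2) u(2) wu] in auto)
qed

section \<open>The universal property in terms of conditions (d) and (e)\<close>

lemma frac_eq_morE:
  assumes "(E, v, g) \<in> spans C W D B" "q \<in> hom C D B" "frac C W E v g = frac C W D (\<i>\<d> D) q"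
  obtains F k where "k \<in> W" "k \<in> hom C F E" "q \<cdot> v \<cdot> k = g \<cdot> k"
proof -
  obtain F u u' where u: "u \<in> W" "u \<in> hom C F E" "u' \<in> hom C F D"
    "v \<cdot> u = \<i>\<d> D \<cdot> u'" "g \<cdot> u = q \<cdot> u'"
    using frac_eqE[OF assms(1) spans_Id[OF assms(2)] assms(3)] .
  then show thesis using that[OF u(1,2)] Id_Comp[OF u(3)] by simp
qed

lemma frac_mor_eqI:
  assumes "v \<in> W" "v \<in> hom C E D" "g \<in> hom C E B" "q \<in> hom C D B" "q \<cdot> v = g"
  shows "frac C W E v g = frac C W D (\<i>\<d> D) q"
  using frac_refine(2)[OF spans_Id[OF assms(4)] assms(2)] Id_Comp[OF assms(2)] assms by simp

text \<open>For the image of a commutative square of \<open>C\<close>, typing and commutativity hold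
  automatically; only the universal property is left.\<close>

lemma is_fiber_product_mor_iff:
  assumes f: "f1 \<in> hom C B1 A" "f2 \<in> hom C B2 A"
    and p: "p1 \<in> hom C P B1" "p2 \<in> hom C P B2" "f1 \<cdot> p1 = f2 \<cdot> p2"
  shows "is_fiber_product (fractions C W) P
           (frac C W P (\<i>\<d> P) p1) (frac C W P (\<i>\<d> P) p2)
           (frac C W B1 (\<i>\<d> B1) f1) (frac C W B2 (\<i>\<d> B2) f2) \<longleftrightarrow>
    (\<forall>X q1 q2. q1 \<in> hom (fractions C W) X B1 \<and> q2 \<in> hom (fractions C W) X B2 \<and>
        frac_comp C W (frac C W B1 (\<i>\<d> B1) f1) q1 = frac_comp C W (frac C W B2 (\<i>\<d> B2) f2) q2 \<longrightarrow>
        (\<exists>!h. h \<in> hom (fractions C W) X P \<and> frac_comp C W (frac C W P (\<i>\<d> P) p1) h = q1 \<and>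
           frac_comp C W (frac C W P (\<i>\<d> P) p2) h = q2))"
proof -
  interpret Q: category "fractions C W" by (rule category_fractions)
  have J: "frac C W B1 (\<i>\<d> B1) f1 \<in> hom (fractions C W) B1 A"
    "frac C W B2 (\<i>\<d> B2) f2 \<in> hom (fractions C W) B2 A"
    "frac C W P (\<i>\<d> P) p1 \<in> hom (fractions C W) P B1"
    "frac C W P (\<i>\<d> P) p2 \<in> hom (fractions C W) P B2"
    using f p by (auto intro!: frac_in_hom spans_Id)
  have eq: "frac_comp C W (frac C W B1 (\<i>\<d> B1) f1) (frac C W P (\<i>\<d> P) p1) =
      frac_comp C W (frac C W B2 (\<i>\<d> B2) f2) (frac C W P (\<i>\<d> P) p2)"
    using frac_comp_mor_frac[OF spans_Id[OF p(1)] f(1)] frac_comp_mor_frac[OF spans_Id[OF p(2)] f(2)]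
      p(3) by simp
  have X: "X \<in> Obj C" if "q \<in> hom (fractions C W) X B1" for X q
    using Q.homD(4)[OF that] by simp
  show ?thesis
    unfolding is_fiber_product_def using eq J X
    by (simp add: Q.homD[OF J(1)] Q.homD[OF J(2)] homD[OF p(1)]) blast
qed

text \<open>This is condition (d), in exactly the form of the final statement so that it can be
  folded there.\<close>

definition weak_lifts where
  "weak_lifts B1 B2 f1 f2 P p1 p2 \<longleftrightarrow>
     (\<forall>D q1 q2. D \<in> Obj C \<and> q1 \<in> hom C D B1 \<and> q2 \<in> hom C D B2 \<and> f1 \<cdot> q1 = f2 \<cdot> q2 \<longrightarrow>
        (\<exists>E v q. E \<in> Obj C \<and> v \<in> W \<and> v \<in> hom C E D \<and> q \<in> hom C E P \<and>
           q1 \<cdot> v = p1 \<cdot> q \<and> q2 \<cdot> v = p2 \<cdot> q))"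

text \<open>This is condition (e), in the same literal form.\<close>

definition weakly_unique_lifts where
  "weakly_unique_lifts B1 B2 f1 f2 P p1 p2 \<longleftrightarrow>
     (\<forall>D q1 q2 E v q E' v' q'.
        D \<in> Obj C \<and> q1 \<in> hom C D B1 \<and> q2 \<in> hom C D B2 \<and> f1 \<cdot> q1 = f2 \<cdot> q2 \<and>
        E \<in> Obj C \<and> v \<in> W \<and> v \<in> hom C E D \<and> q \<in> hom C E P \<and>
        q1 \<cdot> v = p1 \<cdot> q \<and> q2 \<cdot> v = p2 \<cdot> q \<and>
        E' \<in> Obj C \<and> v' \<in> W \<and> v' \<in> hom C E' D \<and> q' \<in> hom C E' P \<and>
        q1 \<cdot> v' = p1 \<cdot> q' \<and> q2 \<cdot> v' = p2 \<cdot> q' \<longrightarrow>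
        (\<exists>F u u'. F \<in> Obj C \<and> u \<in> W \<and> u \<in> hom C F E \<and> u' \<in> hom C F E' \<and>
           v \<cdot> u = v' \<cdot> u' \<and> q \<cdot> u = q' \<cdot> u'))"

text \<open>A cone of \<open>C\<close> is also a cone of fractions. A representative of its
  mediating fraction satisfies the lifting equations of (d) after refinement.\<close>

lemma fiber_product_weak_lifts:
  assumes f: "f1 \<in> hom C B1 A" "f2 \<in> hom C B2 A"
    and p: "p1 \<in> hom C P B1" "p2 \<in> hom C P B2" "f1 \<cdot> p1 = f2 \<cdot> p2"
    and fp: "is_fiber_product (fractions C W) P
           (frac C W P (\<i>\<d> P) p1) (frac C W P (\<i>\<d> P) p2)
           (frac C W B1 (\<i>\<d> B1) f1) (frac C W B2 (\<i>\<d> B2) f2)"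
  shows "weak_lifts B1 B2 f1 f2 P p1 p2"
  unfolding weak_lifts_def
proof (intro allI impI)
  fix D q1 q2
  assume "D \<in> Obj C \<and> q1 \<in> hom C D B1 \<and> q2 \<in> hom C D B2 \<and> f1 \<cdot> q1 = f2 \<cdot> q2"
  then have q: "q1 \<in> hom C D B1" "q2 \<in> hom C D B2" "f1 \<cdot> q1 = f2 \<cdot> q2" by auto
  have "frac_comp C W (frac C W B1 (\<i>\<d> B1) f1) (frac C W D (\<i>\<d> D) q1) =
      frac_comp C W (frac C W B2 (\<i>\<d> B2) f2) (frac C W D (\<i>\<d> D) q2)"
    using frac_comp_mor_frac[OF spans_Id[OF q(1)] f(1)] frac_comp_mor_frac[OF spans_Id[OF q(2)] f(2)]
      q(3) by simp
  then obtain h where h: "h \<in> hom (fractions C W) D P"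
    "frac_comp C W (frac C W P (\<i>\<d> P) p1) h = frac C W D (\<i>\<d> D) q1"
    "frac_comp C W (frac C W P (\<i>\<d> P) p2) h = frac C W D (\<i>\<d> D) q2"
    using fp[unfolded is_fiber_product_mor_iff[OF f p]]
      frac_in_hom[OF spans_Id[OF q(1)]] frac_in_hom[OF spans_Id[OF q(2)]] by metis
  obtain E v r where r: "(E, v, r) \<in> spans C W D P" "h = frac C W E v r"
    using h(1) by (rule hom_fractionsE)
  note s = spansD[OF r(1)]
  have e1: "frac C W E v (p1 \<cdot> r) = frac C W D (\<i>\<d> D) q1"
    and e2: "frac C W E v (p2 \<cdot> r) = frac C W D (\<i>\<d> D) q2"
    using h frac_comp_mor_frac[OF r(1) p(1)] frac_comp_mor_frac[OF r(1) p(2)] r(2) by simp_all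
  have "(E, v, p1 \<cdot> r) \<in> spans C W D B1" and S2: "(E, v, p2 \<cdot> r) \<in> spans C W D B2"
    using s p by (auto intro!: spansI intro: Comp_in_hom)
  from frac_eq_morE[OF this(1) q(1) e1] obtain F k
    where k: "k \<in> W" "k \<in> hom C F E" "q1 \<cdot> v \<cdot> k = (p1 \<cdot> r) \<cdot> k" by blast
  have vk: "v \<cdot> k \<in> W" using W_Comp[OF k(1) s(1) k(2) s(2)] .
  \<comment> \<open>The second equation is moved to the representative already refined by
    \<open>k\<close>, so that the refinement \<open>k \<cdot> l\<close> serves both
    equations.\<close>
  have e2': "frac C W F (v \<cdot> k) ((p2 \<cdot> r) \<cdot> k) = frac C W D (\<i>\<d> D) q2"
    using frac_refine(2)[OF S2 k(2) vk] e2 by simp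
  from frac_eq_morE[OF frac_refine(1)[OF S2 k(2) vk] q(2) this] obtain G l
    where l: "l \<in> W" "l \<in> hom C G F" "q2 \<cdot> (v \<cdot> k) \<cdot> l = ((p2 \<cdot> r) \<cdot> k) \<cdot> l" by blast
  note [simp] = homD[OF s(2)] homD[OF s(3)] homD[OF p(1)] homD[OF p(2)] homD[OF k(2)] homD[OF l(2)]
    homD[OF q(1)] homD[OF q(2)]
  have "v \<cdot> k \<cdot> l \<in> W" using W_Comp3[OF vk l(1,2) k(2) s(2)] .
  moreover have "q1 \<cdot> v \<cdot> k \<cdot> l = p1 \<cdot> r \<cdot> k \<cdot> l"
    using arg_cong[OF k(3), of "\<lambda>x. x \<cdot> l"] by simp
  moreover have "q2 \<cdot> v \<cdot> k \<cdot> l = p2 \<cdot> r \<cdot> k \<cdot> l" using l(3) by simp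
  moreover have "v \<cdot> k \<cdot> l \<in> hom C G D" "r \<cdot> k \<cdot> l \<in> hom C G P" "G \<in> Obj C"
    by (auto intro!: homI)
  ultimately show "\<exists>E v q. E \<in> Obj C \<and> v \<in> W \<and> v \<in> hom C E D \<and> q \<in> hom C E P \<and>
      q1 \<cdot> v = p1 \<cdot> q \<and> q2 \<cdot> v = p2 \<cdot> q" by blast
qed

text \<open>Two choices of data as in (d) are two fractions mediating the same cone. Uniqueness
  equates them, and \<open>frac_eqE\<close> unpacks the equality with \<open>u\<close> in
  \<open>W\<close>.\<close>

lemma fiber_product_weakly_unique_lifts:
  assumes f: "f1 \<in> hom C B1 A" "f2 \<in> hom C B2 A"
    and p: "p1 \<in> hom C P B1" "p2 \<in> hom C P B2" "f1 \<cdot> p1 = f2 \<cdot> p2"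
    and fp: "is_fiber_product (fractions C W) P
           (frac C W P (\<i>\<d> P) p1) (frac C W P (\<i>\<d> P) p2)
           (frac C W B1 (\<i>\<d> B1) f1) (frac C W B2 (\<i>\<d> B2) f2)"
  shows "weakly_unique_lifts B1 B2 f1 f2 P p1 p2"
  unfolding weakly_unique_lifts_def
proof (intro allI impI, elim conjE)
  fix D q1 q2 E v r E' v' r'
  assume q: "q1 \<in> hom C D B1" "q2 \<in> hom C D B2" "f1 \<cdot> q1 = f2 \<cdot> q2"
    and r: "v \<in> W" "v \<in> hom C E D" "r \<in> hom C E P" "q1 \<cdot> v = p1 \<cdot> r" "q2 \<cdot> v = p2 \<cdot> r"
    and r': "v' \<in> W" "v' \<in> hom C E' D" "r' \<in> hom C E' P" "q1 \<cdot> v' = p1 \<cdot> r'" "q2 \<cdot> v' = p2 \<cdot> r'"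
  have lift: "frac_comp C W (frac C W P (\<i>\<d> P) p1) (frac C W E v r) = frac C W D (\<i>\<d> D) q1"
    "frac_comp C W (frac C W P (\<i>\<d> P) p2) (frac C W E v r) = frac C W D (\<i>\<d> D) q2"
    if "v \<in> W" "v \<in> hom C E D" "r \<in> hom C E P" "q1 \<cdot> v = p1 \<cdot> r" "q2 \<cdot> v = p2 \<cdot> r" for E v r
    using frac_comp_mor_frac[OF spansI[OF that(1-3)]] p
      frac_mor_eqI[OF that(1,2) Comp_in_hom[OF that(3) p(1)] q(1) that(4)]
      frac_mor_eqI[OF that(1,2) Comp_in_hom[OF that(3) p(2)] q(2) that(5)] by auto
  have "frac_comp C W (frac C W B1 (\<i>\<d> B1) f1) (frac C W D (\<i>\<d> D) q1) =
      frac_comp C W (frac C W B2 (\<i>\<d> B2) f2) (frac C W D (\<i>\<d> D) q2)"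
    using frac_comp_mor_frac[OF spans_Id[OF q(1)] f(1)] frac_comp_mor_frac[OF spans_Id[OF q(2)] f(2)]
      q(3) by simp
  then have "\<exists>!h. h \<in> hom (fractions C W) D P \<and>
      frac_comp C W (frac C W P (\<i>\<d> P) p1) h = frac C W D (\<i>\<d> D) q1 \<and>
      frac_comp C W (frac C W P (\<i>\<d> P) p2) h = frac C W D (\<i>\<d> D) q2"
    using fp[unfolded is_fiber_product_mor_iff[OF f p]]
      frac_in_hom[OF spans_Id[OF q(1)]] frac_in_hom[OF spans_Id[OF q(2)]] by blast
  then have eq: "frac C W E v r = frac C W E' v' r'"
    using lift[OF r] lift[OF r'] frac_in_hom[OF spansI[OF r(1-3)]] frac_in_hom[OF spansI[OF r'(1-3)]]
    by blast
  obtain F u u' where u: "u \<in> W" "u \<in> hom C F E" "u' \<in> hom C F E'"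
    "v \<cdot> u = v' \<cdot> u'" "r \<cdot> u = r' \<cdot> u'"
    using frac_eqE[OF spansI[OF r(1-3)] spansI[OF r'(1-3)] eq] .
  then show "\<exists>F u u'. F \<in> Obj C \<and> u \<in> W \<and> u \<in> hom C F E \<and> u' \<in> hom C F E' \<and>
      v \<cdot> u = v' \<cdot> u' \<and> r \<cdot> u = r' \<cdot> u'"
    using homD(4)[OF u(2)] by blast
qed

text \<open>(d) applied to the numerators of a cone lifts them, which gives a mediating fraction.
  For uniqueness, (e) is applied to a cone of \<open>C\<close> obtained from the numerators of two
  mediating fractions.\<close>

lemma fiber_productI_weak_lifts:
  assumes f: "f1 \<in> hom C B1 A" "f2 \<in> hom C B2 A"
    and p: "p1 \<in> hom C P B1" "p2 \<in> hom C P B2" "f1 \<cdot> p1 = f2 \<cdot> p2"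
    and d: "weak_lifts B1 B2 f1 f2 P p1 p2" and e: "weakly_unique_lifts B1 B2 f1 f2 P p1 p2"
  shows "is_fiber_product (fractions C W) P
           (frac C W P (\<i>\<d> P) p1) (frac C W P (\<i>\<d> P) p2)
           (frac C W B1 (\<i>\<d> B1) f1) (frac C W B2 (\<i>\<d> B2) f2)"
  unfolding is_fiber_product_mor_iff[OF f p]
proof (intro allI impI, elim conjE)
  fix X q1 q2
  assume q: "q1 \<in> hom (fractions C W) X B1" "q2 \<in> hom (fractions C W) X B2"
    "frac_comp C W (frac C W B1 (\<i>\<d> B1) f1) q1 = frac_comp C W (frac C W B2 (\<i>\<d> B2) f2) q2"
  obtain D u g1 g2 where g: "(D, u, g1) \<in> spans C W X B1" "(D, u, g2) \<in> spans C W X B2"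
    "q1 = frac C W D u g1" "q2 = frac C W D u g2" "f1 \<cdot> g1 = f2 \<cdot> g2"
    using cone_representatives[OF f q] .
  note s1 = spansD[OF g(1)] and s2 = spansD[OF g(2)]
  obtain E v r where r: "v \<in> W" "v \<in> hom C E D" "r \<in> hom C E P" "g1 \<cdot> v = p1 \<cdot> r" "g2 \<cdot> v = p2 \<cdot> r"
    using d s1 s2 g(5) homD(4)[OF s1(2)] unfolding weak_lifts_def by blast
  have uv: "u \<cdot> v \<in> W" using W_Comp[OF r(1) s1(1) r(2) s1(2)] .
  have S: "(E, u \<cdot> v, r) \<in> spans C W X P" using uv Comp_in_hom[OF r(2) s1(2)] r(3) by (rule spansI)
  show "\<exists>!h. h \<in> hom (fractions C W) X P \<and> frac_comp C W (frac C W P (\<i>\<d> P) p1) h = q1 \<and>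
      frac_comp C W (frac C W P (\<i>\<d> P) p2) h = q2"
  proof (rule ex_ex1I)
    have "frac_comp C W (frac C W P (\<i>\<d> P) p1) (frac C W E (u \<cdot> v) r) = q1"
      using frac_comp_mor_frac[OF S p(1)] frac_refine(2)[OF g(1) r(2) uv] r(4) g(3) by simp
    moreover have "frac_comp C W (frac C W P (\<i>\<d> P) p2) (frac C W E (u \<cdot> v) r) = q2"
      using frac_comp_mor_frac[OF S p(2)] frac_refine(2)[OF g(2) r(2) uv] r(5) g(4) by simp
    ultimately show "\<exists>h. h \<in> hom (fractions C W) X P \<and>
        frac_comp C W (frac C W P (\<i>\<d> P) p1) h = q1 \<and> frac_comp C W (frac C W P (\<i>\<d> P) p2) h = q2"
      using frac_in_hom[OF S] by blast
  next
    fix h h'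
    assume h: "h \<in> hom (fractions C W) X P \<and> frac_comp C W (frac C W P (\<i>\<d> P) p1) h = q1 \<and>
        frac_comp C W (frac C W P (\<i>\<d> P) p2) h = q2"
      and h': "h' \<in> hom (fractions C W) X P \<and> frac_comp C W (frac C W P (\<i>\<d> P) p1) h' = q1 \<and>
        frac_comp C W (frac C W P (\<i>\<d> P) p2) h' = q2"
    have hh: "h \<in> hom (fractions C W) X P" "h' \<in> hom (fractions C W) X P"
      "frac_comp C W (frac C W P (\<i>\<d> P) p1) h = frac_comp C W (frac C W P (\<i>\<d> P) p1) h'"
      using h h' by auto
    \<comment> \<open>A cone over the pair \<open>(p1, p1)\<close>: this gives a common denominator
      and the equation for \<open>p1\<close> at once.\<close>
    obtain D u k k' where k: "(D, u, k) \<in> spans C W X P" "(D, u, k') \<in> spans C W X P"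
      "h = frac C W D u k" "h' = frac C W D u k'" "p1 \<cdot> k = p1 \<cdot> k'"
      using cone_representatives[OF p(1) p(1) hh] .
    note t = spansD[OF k(1)] and t' = spansD[OF k(2)]
    have "frac C W D u (p2 \<cdot> k) = frac C W D u (p2 \<cdot> k')"
      using h h' k(3,4) frac_comp_mor_frac[OF k(1) p(2)] frac_comp_mor_frac[OF k(2) p(2)] by simp
    then obtain F l where l: "l \<in> W" "l \<in> hom C F D" "(p2 \<cdot> k) \<cdot> l = (p2 \<cdot> k') \<cdot> l"
      using frac_eq_same_denomE[OF spansI[OF t(1,2) Comp_in_hom[OF t(3) p(2)]]
          spansI[OF t(1,2) Comp_in_hom[OF t'(3) p(2)]]] by blast
    note [simp] = homD[OF t(2)] homD[OF t(3)] homD[OF t'(3)] homD[OF p(1)] homD[OF p(2)] homD[OF l(2)]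
      homD[OF f(1)] homD[OF f(2)]
    have ul: "u \<cdot> l \<in> W" using W_Comp[OF l(1) t(1) l(2) t(2)] .
    have "p1 \<cdot> k \<cdot> l = p1 \<cdot> k' \<cdot> l" "p2 \<cdot> k \<cdot> l = p2 \<cdot> k' \<cdot> l"
      using arg_cong[OF k(5), of "\<lambda>x. x \<cdot> l"] l(3) by simp_all
    moreover have kl: "k \<cdot> l \<in> hom C F P" "k' \<cdot> l \<in> hom C F P" by (auto intro!: homI)
    moreover have "f1 \<cdot> p1 \<cdot> k \<cdot> l = f2 \<cdot> p2 \<cdot> k \<cdot> l"
      by (rule Comp_eq_extend[OF p(3,1) f(1) p(2) f(2) kl(1)])
    moreover have "p1 \<cdot> k \<cdot> l \<in> hom C F B1" "p2 \<cdot> k \<cdot> l \<in> hom C F B2" "\<i>\<d> F \<in> hom C F F" "\<i>\<d> F \<in> W"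
      "F \<in> Obj C"
      using CF1 Id_in_hom by (auto intro!: homI)
    moreover have "(p1 \<cdot> k \<cdot> l) \<cdot> \<i>\<d> F = p1 \<cdot> k \<cdot> l" "(p2 \<cdot> k \<cdot> l) \<cdot> \<i>\<d> F = p2 \<cdot> k \<cdot> l"
      using calculation by (auto intro!: Comp_Id)
    \<comment> \<open>Both \<open>k \<cdot> l\<close> and \<open>k' \<cdot> l\<close> lift the same
      cone on \<open>F\<close> with the identity as refinement, so (e) compares them; the identities
      will force \<open>m' = m\<close>.\<close>
    ultimately obtain G m m' where m: "m \<in> W" "m \<in> hom C G F" "m' \<in> hom C G F"
      "\<i>\<d> F \<cdot> m = \<i>\<d> F \<cdot> m'" "(k \<cdot> l) \<cdot> m = (k' \<cdot> l) \<cdot> m'"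
      using e[unfolded weakly_unique_lifts_def, rule_format,
          of F "p1 \<cdot> k \<cdot> l" "p2 \<cdot> k \<cdot> l" F "\<i>\<d> F" "k \<cdot> l" F "\<i>\<d> F" "k' \<cdot> l"] by metis
    have mm: "m' = m" using m(4) Id_Comp[OF m(2)] Id_Comp[OF m(3)] by simp
    note [simp] = homD[OF m(2)]
    have "frac C W D u k = frac C W D u k'"
      by (rule frac_eqI[OF k(1,2), of "l \<cdot> m" G "l \<cdot> m"])
        (use W_Comp3[OF ul m(1,2) l(2) t(2)] m(5) mm in \<open>auto intro!: homI\<close>)
    then show "h = h'" using k by simp
  qed
qed

text \<open>The two projections get a common denominator \<open>u\<close> and numerators that
  commute in \<open>C\<close>. Moving the apex along the isomorphism given by \<open>u\<close> then
  cancels \<open>u\<close>.\<close>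

lemma fiber_product_strictify:
  assumes f: "f1 \<in> hom C B1 A" "f2 \<in> hom C B2 A"
    and fp: "is_fiber_product (fractions C W) P r1 r2
      (frac C W B1 (\<i>\<d> B1) f1) (frac C W B2 (\<i>\<d> B2) f2)"
  obtains D p1 p2 where "D \<in> Obj C" "p1 \<in> hom C D B1" "p2 \<in> hom C D B2" "f1 \<cdot> p1 = f2 \<cdot> p2"
    "is_fiber_product (fractions C W) D (frac C W D (\<i>\<d> D) p1) (frac C W D (\<i>\<d> D) p2)
      (frac C W B1 (\<i>\<d> B1) f1) (frac C W B2 (\<i>\<d> B2) f2)"
proof -
  interpret Q: category "fractions C W" by (rule category_fractions)
  note J1 = Q.homD[OF frac_in_hom[OF spans_Id[OF f(1)]]]
    and J2 = Q.homD[OF frac_in_hom[OF spans_Id[OF f(2)]]]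
  have r: "r1 \<in> hom (fractions C W) P B1" "r2 \<in> hom (fractions C W) P B2"
    "frac_comp C W (frac C W B1 (\<i>\<d> B1) f1) r1 = frac_comp C W (frac C W B2 (\<i>\<d> B2) f2) r2"
    using fp J1 J2 unfolding is_fiber_product_def by simp_all
  obtain D u p1 p2 where p: "(D, u, p1) \<in> spans C W P B1" "(D, u, p2) \<in> spans C W P B2"
    "r1 = frac C W D u p1" "r2 = frac C W D u p2" "f1 \<cdot> p1 = f2 \<cdot> p2"
    using cone_representatives[OF f r] .
  note s1 = spansD[OF p(1)] and s2 = spansD[OF p(2)]
  have D: "D \<in> Obj C" using homD(4)[OF s1(2)] .
  have "is_fiber_product (fractions C W) D
      (frac_comp C W r1 (frac C W D (\<i>\<d> D) u)) (frac_comp C W r2 (frac C W D (\<i>\<d> D) u))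
      (frac C W B1 (\<i>\<d> B1) f1) (frac C W B2 (\<i>\<d> B2) f2)"
    using Q.is_fiber_product_iso_apex[OF fp iso_W(1)[OF s1(1,2)] iso_W(2)[OF s1(1,2)]]
      iso_W(3,4)[OF s1(1,2)] by simp
  then show thesis
    using that[OF D s1(3) s2(3) p(5)] p(3,4) frac_comp_frac_W[OF p(1) CF1 Id_in_hom]
      frac_comp_frac_W[OF p(2) CF1 Id_in_hom] D by simp
qed

text \<open>Each fraction with denominator \<open>w\<close> is the one with identity denominator
  composed with the inverse of the isomorphism given by \<open>w\<close>, so the feet are replaced
  along these isomorphisms.\<close>

lemma fiber_product_change_denominators:
  assumes f: "f1 \<in> hom C B1 A" "f2 \<in> hom C B2 A"
    and w: "w1 \<in> W" "w1 \<in> hom C B1 B1'" "w2 \<in> W" "w2 \<in> hom C B2 B2'"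
    and fp: "is_fiber_product (fractions C W) P r1 r2
      (frac C W B1 (\<i>\<d> B1) f1) (frac C W B2 (\<i>\<d> B2) f2)"
  shows "is_fiber_product (fractions C W) P
      (frac_comp C W (frac C W B1 (\<i>\<d> B1) w1) r1) (frac_comp C W (frac C W B2 (\<i>\<d> B2) w2) r2)
      (frac C W B1 w1 f1) (frac C W B2 w2 f2)"
proof -
  interpret Q: category "fractions C W" by (rule category_fractions)
  note B = homD(4)[OF f(1)] homD(4)[OF f(2)]
  have "frac_comp C W (frac C W B1 (\<i>\<d> B1) f1) (frac C W B1 w1 (\<i>\<d> B1)) = frac C W B1 w1 f1"
    "frac_comp C W (frac C W B2 (\<i>\<d> B2) f2) (frac C W B2 w2 (\<i>\<d> B2)) = frac C W B2 w2 f2"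
    using frac_comp_frac_W[OF spans_Id[OF f(1)] w(1,2)] frac_comp_frac_W[OF spans_Id[OF f(2)] w(3,4)] .
  then show ?thesis
    using Q.is_fiber_product_iso_feet[OF fp frac_in_hom[OF spans_Id[OF f(1)]]
        frac_in_hom[OF spans_Id[OF f(2)]] iso_W(1)[OF w(1,2)] iso_W(1)[OF w(3,4)]
        iso_W(2)[OF w(1,2)] iso_W(2)[OF w(3,4)]]
      iso_W(3,4)[OF w(1,2)] iso_W(3,4)[OF w(3,4)] by simp
qed

end

theorem proposition0p4:
  fixes C :: "('o, 'm) category" (structure)
    and W :: "'m set"
    and A B1 B2 :: 'o
    and f1 f2 :: 'm
  assumes "right_calculus_of_fractions C W"
    and "f1 \<in> hom C B1 A"
    and "f2 \<in> hom C B2 A"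
  shows
    "((\<forall>B1' B2' w1 w2.
         w1 \<in> W \<and> w1 \<in> hom C B1 B1' \<and> w2 \<in> W \<and> w2 \<in> hom C B2 B2' \<longrightarrow>
         (\<exists>P r1 r2. is_fiber_product (fractions C W) P r1 r2 (frac C W B1 w1 f1) (frac C W B2 w2 f2)))
      \<longleftrightarrow>
      (\<exists>P p1 p2. P \<in> Obj C \<and> p1 \<in> hom C P B1 \<and> p2 \<in> hom C P B2 \<and> f1 \<cdot> p1 = f2 \<cdot> p2 \<and>
         is_fiber_product (fractions C W) P
           (frac C W P (\<i>\<d> P) p1) (frac C W P (\<i>\<d> P) p2)
           (frac C W B1 (\<i>\<d> B1) f1) (frac C W B2 (\<i>\<d> B2) f2)))
     \<and>
     (\<forall>P p1 p2. P \<in> Obj C \<and> p1 \<in> hom C P B1 \<and> p2 \<in> hom C P B2 \<and> f1 \<cdot> p1 = f2 \<cdot> p2 \<longrightarrow>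
        (is_fiber_product (fractions C W) P
           (frac C W P (\<i>\<d> P) p1) (frac C W P (\<i>\<d> P) p2)
           (frac C W B1 (\<i>\<d> B1) f1) (frac C W B2 (\<i>\<d> B2) f2)
         \<longleftrightarrow>
         (\<forall>D q1 q2. D \<in> Obj C \<and> q1 \<in> hom C D B1 \<and> q2 \<in> hom C D B2 \<and> f1 \<cdot> q1 = f2 \<cdot> q2 \<longrightarrow>
            (\<exists>E v q. E \<in> Obj C \<and> v \<in> W \<and> v \<in> hom C E D \<and> q \<in> hom C E P \<and>
               q1 \<cdot> v = p1 \<cdot> q \<and> q2 \<cdot> v = p2 \<cdot> q))
         \<and>
         (\<forall>D q1 q2 E v q E' v' q'.
            D \<in> Obj C \<and> q1 \<in> hom C D B1 \<and> q2 \<in> hom C D B2 \<and> f1 \<cdot> q1 = f2 \<cdot> q2 \<and>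
            E \<in> Obj C \<and> v \<in> W \<and> v \<in> hom C E D \<and> q \<in> hom C E P \<and>
            q1 \<cdot> v = p1 \<cdot> q \<and> q2 \<cdot> v = p2 \<cdot> q \<and>
            E' \<in> Obj C \<and> v' \<in> W \<and> v' \<in> hom C E' D \<and> q' \<in> hom C E' P \<and>
            q1 \<cdot> v' = p1 \<cdot> q' \<and> q2 \<cdot> v' = p2 \<cdot> q' \<longrightarrow>
            (\<exists>F u u'. F \<in> Obj C \<and> u \<in> W \<and> u \<in> hom C F E \<and> u' \<in> hom C F E' \<and>
               v \<cdot> u = v' \<cdot> u' \<and> q \<cdot> u = q' \<cdot> u'))))"
proof -
  interpret right_calculus_of_fractions C W by fact
  note f = assms(2,3)
  have B: "B1 \<in> Obj C" "B2 \<in> Obj C" using homD(4) f by blast+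
  let ?iv = "\<exists>P p1 p2. P \<in> Obj C \<and> p1 \<in> hom C P B1 \<and> p2 \<in> hom C P B2 \<and> f1 \<cdot> p1 = f2 \<cdot> p2 \<and>
         is_fiber_product (fractions C W) P
           (frac C W P (\<i>\<d> P) p1) (frac C W P (\<i>\<d> P) p2)
           (frac C W B1 (\<i>\<d> B1) f1) (frac C W B2 (\<i>\<d> B2) f2)"
  show ?thesis (is "(?iii \<longleftrightarrow> _) \<and> ?moreover")
  proof (intro conjI iffI)
    \<comment> \<open>(CF1) allows identity denominators in (iii). The resulting fiber product has
      arbitrary fractions as projections, which still have to be made strict.\<close>
    assume ?iii
    then obtain P r1 r2 where "is_fiber_product (fractions C W) P r1 r2
        (frac C W B1 (\<i>\<d> B1) f1) (frac C W B2 (\<i>\<d> B2) f2)"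
      using CF1[OF B(1)] CF1[OF B(2)] Id_in_hom[OF B(1)] Id_in_hom[OF B(2)] by blast
    then show ?iv using fiber_product_strictify[OF f] by metis
  next
    assume ?iv
    then show ?iii using fiber_product_change_denominators[OF f] by blast
  next
    show ?moreover
      using fiber_product_weak_lifts[OF f] fiber_product_weakly_unique_lifts[OF f]
        fiber_productI_weak_lifts[OF f]
      unfolding weak_lifts_def[symmetric] weakly_unique_lifts_def[symmetric] by blast
  qed
qed

end
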